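(* Let $a,b\in\mathbb{R}$ with $a<b$ and $I:=(a,b)$. Let $\bar p_\infty\in L^\infty(I)\setminus\{0\}$ be real-valued with $\bar p_\infty\ge0$ a.e., and let $\bar p_1,\bar p_2,\dots$ be a sequence of real-valued elements of $L^\infty(I)\setminus\{0\}$, each $\ge0$ a.e., such that $\lim_{\nu\to\infty}\|\bar p_\nu-\bar p_\infty\|_1=0$. Let $\hat A_\nu:=\hat A_{\bar p_\nu}$ for $\nu\in\{1,2,\dots\}$ and $\hat A_\infty:=\hat A_{\bar p_\infty}$ be the associated self-adjoint operators. Then, in operator norm on $(L^2_{\mathbb{C}}(I))^2$, $$\lim_{\nu\to\infty}\|\hat A_\nu^{-1}-\hat A_\infty^{-1}\|=0 .$$
   Context: $L^2_{\mathbb{C}}(I)$ is the Hilbert space of complex-valued square-integrable functions on $I$; $(L^2_{\mathbb{C}}(I))^2$ carries the product Hilbert norm; $\|\cdot\|_1$ is the $L^1(I)$-norm. $D_I:C_0^\infty(I,\mathbb{C})\to L^2_{\mathbb{C}}(I)$, $D_If=f'$, is a densely-defined operator in $L^2_{\mathbb{C}}(I)$, with Hilbert space adjoint $D_I^*$; its domain is the Sobolev space $D(D_I^* )=W^1_{\mathbb{C}}(I)$, and $-D_I^*$ is the weak derivative. $W^1_{0,\mathbb{C}}(I)$ is the closure of $C_0^\infty(I,\mathbb{C})$ in $W^1_{\mathbb{C}}(I)$ with respect to the norm $(\|f\|_2^2+\|D_I^*f\|_2^2)^{1/2}$. For real-valued $\bar p\in L^\infty(I)$, $\hat A_{\bar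 p}:W^1_{0,\mathbb{C}}(I)\times D(D_I^* )\to(L^2_{\mathbb{C}}(I))^2$ is the densely-defined operator in $(L^2_{\mathbb{C}}(I))^2$ given by $\hat A_{\bar p}(u,q)=(D_I^*q,\ -D_I^*u-\bar p\,q)$. For $\bar p\in L^\infty(I)\setminus\{0\}$ with $\bar p\ge0$ a.e. it is self-adjoint and bijective with bounded inverse. *)

theory Defs
  imports "HOL-Analysis.Analysis"
begin

text \<open>
  Elements of \<open>L\<^sup>2\<close> and of \<open>L\<^sup>\<infinity>\<close> are represented by functions; only their values on \<open>I\<close>, up to
  Lebesgue null sets, matter. Accordingly an (unbounded) operator is represented by its graph, a
  relation on representatives that is closed under almost everywhere equality in both components.
\<close>

definition L2 :: "real set \<Rightarrow> (real \<Rightarrow> complex) set" where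
  "L2 I = {f \<in> borel_measurable (lebesgue_on I). integrable (lebesgue_on I) (\<lambda>x. (cmod (f x))\<^sup>2)}"

definition L2_inner :: "real set \<Rightarrow> (real \<Rightarrow> complex) \<Rightarrow> (real \<Rightarrow> complex) \<Rightarrow> complex" where
  "L2_inner I f g = (LINT x|lebesgue_on I. f x * cnj (g x))"

definition L2_norm :: "real set \<Rightarrow> (real \<Rightarrow> complex) \<Rightarrow> real" where
  "L2_norm I f = sqrt (LINT x|lebesgue_on I. (cmod (f x))\<^sup>2)"

definition Linfty :: "real set \<Rightarrow> (real \<Rightarrow> real) set" where
  "Linfty I = {p \<in> borel_measurable (lebesgue_on I). \<exists>C. AE x in lebesgue_on I. \<bar>p x\<bar> \<le> C}"

definition L1_norm :: "real set \<Rightarrow> (real \<Rightarrow> real) \<Rightarrow> real" where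
  "L1_norm I p = (LINT x|lebesgue_on I. \<bar>p x\<bar>)"

definition smooth :: "(real \<Rightarrow> complex) \<Rightarrow> bool" where
  "smooth f \<longleftrightarrow> (\<exists>F :: nat \<Rightarrow> real \<Rightarrow> complex.
     F 0 = f \<and> (\<forall>n x. (F n has_vector_derivative F (Suc n) x) (at x)))"

text \<open>Functions in \<open>C\<^sub>0\<^sup>\<infinity>(I, \<complex>)\<close> are identified with their extensions by zero to the real line.\<close>

definition C0_infty :: "real set \<Rightarrow> (real \<Rightarrow> complex) set" where
  "C0_infty I = {f. smooth f \<and> compact (closure {x. f x \<noteq> 0}) \<and> closure {x. f x \<noteq> 0} \<subseteq> I}"

definition D_op :: "real set \<Rightarrow> ((real \<Rightarrow> complex) \<times> (real \<Rightarrow> complex)) set" where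
  "D_op I = {(f, g). f \<in> L2 I \<and> g \<in> L2 I \<and>
     (\<exists>\<phi> \<in> C0_infty I. (AE x in lebesgue_on I. f x = \<phi> x) \<and>
        (AE x in lebesgue_on I. g x = vector_derivative \<phi> (at x)))}"

definition L2_adjoint :: "real set \<Rightarrow> ((real \<Rightarrow> complex) \<times> (real \<Rightarrow> complex)) set
    \<Rightarrow> ((real \<Rightarrow> complex) \<times> (real \<Rightarrow> complex)) set" where
  "L2_adjoint I T = {(q, r). q \<in> L2 I \<and> r \<in> L2 I \<and>
     (\<forall>(f, g) \<in> T. L2_inner I g q = L2_inner I f r)}"

text \<open>
  A representative of the value at \<open>x\<close> of the operator with graph \<open>T\<close>, for \<open>x\<close> in the domain of \<open>T\<close>.
\<close>

definition op_apply :: "('a \<times> 'b) set \<Rightarrow> 'a \<Rightarrow> 'b" where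
  "op_apply T x = (SOME y. (x, y) \<in> T)"

definition D_adj :: "real set \<Rightarrow> (real \<Rightarrow> complex) \<Rightarrow> real \<Rightarrow> complex" where
  "D_adj I = op_apply (L2_adjoint I (D_op I))"

definition W1 :: "real set \<Rightarrow> (real \<Rightarrow> complex) set" where
  "W1 I = Domain (L2_adjoint I (D_op I))"

definition W1_norm :: "real set \<Rightarrow> (real \<Rightarrow> complex) \<Rightarrow> real" where
  "W1_norm I f = sqrt ((L2_norm I f)\<^sup>2 + (L2_norm I (D_adj I f))\<^sup>2)"

definition W10 :: "real set \<Rightarrow> (real \<Rightarrow> complex) set" where
  "W10 I = {u \<in> W1 I. \<forall>e>0. \<exists>\<phi> \<in> C0_infty I. W1_norm I (\<lambda>x. u x - \<phi> x) < e}"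

type_synonym cfun2 = "(real \<Rightarrow> complex) \<times> (real \<Rightarrow> complex)"

definition L2_prod_norm :: "real set \<Rightarrow> cfun2 \<Rightarrow> real" where
  "L2_prod_norm I h = sqrt ((L2_norm I (fst h))\<^sup>2 + (L2_norm I (snd h))\<^sup>2)"

definition A_hat :: "real set \<Rightarrow> (real \<Rightarrow> real) \<Rightarrow> (cfun2 \<times> cfun2) set" where
  "A_hat I p = {((u, q), (f, g)). u \<in> W10 I \<and> q \<in> W1 I \<and> f \<in> L2 I \<and> g \<in> L2 I \<and>
     (AE x in lebesgue_on I. f x = D_adj I q x) \<and>
     (AE x in lebesgue_on I. g x = - D_adj I u x - complex_of_real (p x) * q x)}"

text \<open>
  For \<open>p \<ge> 0\<close>, \<open>p \<noteq> 0\<close> the operator is bijective, i.e. the converse of its graph is total on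
  \<open>L\<^sup>2 \<times> L\<^sup>2\<close> and single-valued up to almost everywhere equality.
\<close>

definition A_hat_inv :: "real set \<Rightarrow> (real \<Rightarrow> real) \<Rightarrow> cfun2 \<Rightarrow> cfun2" where
  "A_hat_inv I p = op_apply ((A_hat I p)\<inverse>)"

text \<open>
  The operator norm takes values in the extended nonnegative reals, so that it is \<open>\<infinity>\<close> for an
  unbounded operator.
\<close>

definition L2_prod_opnorm :: "real set \<Rightarrow> (cfun2 \<Rightarrow> cfun2) \<Rightarrow> ennreal" where
  "L2_prod_opnorm I F =
     (SUP h \<in> {h \<in> L2 I \<times> L2 I. L2_prod_norm I h \<le> 1}. ennreal (L2_prod_norm I (F h)))"

end

theory Submission
  imports Defs
begin

text \<open>
  Writing out \<open>A(u, q) = (f, g)\<close> gives the two-point boundary value problem \<open>-q' = f\<close>,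
  \<open>u' - p q = g\<close>, \<open>u(a) = u(b) = 0\<close>, which is solved by two integrations:
  \<open>q = c - F\<close> with \<open>F(x)\<close> the integral of \<open>f\<close> from \<open>a\<close> to \<open>x\<close>, and \<open>u\<close> is the primitive of
  \<open>g + p q\<close> starting at \<open>a\<close>. The condition at \<open>b\<close> fixes the constant:
  \<open>c = (\<integral> p F - \<integral> g) / \<integral> p\<close>, where \<open>\<integral> p > 0\<close>. In this formula \<open>p\<close> occurs only under an
  integral and multiplied by functions that are bounded uniformly for \<open>(f, g)\<close> in the unit ball (by
  Cauchy-Schwarz, \<open>|F| \<le> sqrt(b - a)\<close>). Hence the inverse depends on \<open>p\<close> in a locally Lipschitz way
  with respect to the \<open>L\<^sup>1\<close>-norm, which is \<open>A_hat_inv_difference_bound\<close>, and the theorem follows.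
  
  The larger part of the work is to justify the formula, as the operators are given through the
  adjoint of the derivative on test functions and through a closure of test functions. Two facts do
  this. By \<open>D_adjoint_primitive\<close> and \<open>D_adjoint_imp_primitive\<close>, \<open>r\<close> is the adjoint derivative of \<open>q\<close>
  if and only if \<open>q\<close> is almost everywhere a constant minus the primitive of \<open>r\<close>. By \<open>W10_I\<close> and
  \<open>W10_D\<close>, the space \<open>W10\<close> consists of the primitives, starting at \<open>a\<close>, of square-integrable
  functions with integral zero. Both rest on two density statements: test functions are dense in
  \<open>L\<^sup>2\<close> (\<open>C0_infty_dense\<close>), and their derivatives are dense among the functions with integral zero
  (\<open>derivatives_dense_in_mean_zero\<close>).
\<close>

section \<open>Smooth functions with compact support\<close>

text \<open>
  Derivatives of all orders exist as soon as the function lies in some class that is closed under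
  differentiation. Exhibiting such a class avoids explicit formulas for the higher derivatives.
\<close>

lemma smooth_coinduct:
  assumes "f \<in> S"
    and step: "\<And>g. g \<in> S \<Longrightarrow> \<exists>g'\<in>S. \<forall>x. (g has_vector_derivative g' x) (at x)"
  shows "smooth f"
proof -
  obtain D where D: "\<And>g. g \<in> S \<Longrightarrow> D g \<in> S"
      "\<And>g x. g \<in> S \<Longrightarrow> (g has_vector_derivative D g x) (at x)"
    using step by metis
  have "(D ^^ n) f \<in> S" for n
    by (induction n) (use assms(1) D(1) in auto)
  then show ?thesis
    unfolding smooth_def by (intro exI[of _ "\<lambda>n. (D ^^ n) f"]) (auto intro: D(2))
qed

lemma smooth_derivE:
  assumes "smooth f"
  obtains f' where "smooth f'" "\<And>x. (f has_vector_derivative f' x) (at x)"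
proof -
  obtain F where F: "F 0 = f" "\<And>n x. (F n has_vector_derivative F (Suc n) x) (at x)"
    using assms unfolding smooth_def by blast
  have "smooth (F 1)"
    unfolding smooth_def by (intro exI[of _ "\<lambda>n. F (Suc n)"]) (auto intro: F(2))
  then show thesis
    using F(2)[of 0] F(1) that by auto
qed

lemma smooth_add:
  assumes "smooth f" "smooth g"
  shows "smooth (\<lambda>x. f x + g x)"
proof (rule smooth_coinduct)
  show "(\<lambda>x. f x + g x) \<in> {\<lambda>x. f x + g x | f g. smooth f \<and> smooth g}"
    using assms by blast
next
  fix h assume "h \<in> {\<lambda>x. f x + g x | f g. smooth f \<and> smooth g}"
  then obtain f g where h: "h = (\<lambda>x. f x + g x)" and "smooth f" "smooth g" by blast
  then obtain f' g' where "smooth f'" "smooth g'"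
      and "\<And>x. (f has_vector_derivative f' x) (at x)" "\<And>x. (g has_vector_derivative g' x) (at x)"
    by (metis smooth_derivE)
  then show "\<exists>h'\<in>{\<lambda>x. f x + g x | f g. smooth f \<and> smooth g}.
      \<forall>x. (h has_vector_derivative h' x) (at x)"
    unfolding h by (intro bexI[of _ "\<lambda>x. f' x + g' x"]) (auto intro: has_vector_derivative_add)
qed

text \<open>
  By the Leibniz rule the products of smooth functions are not closed under differentiation, but
  their finite sums are.
\<close>

inductive_set sums_of_products :: "(real \<Rightarrow> complex) set" where
  product: "smooth f \<Longrightarrow> smooth g \<Longrightarrow> (\<lambda>x. f x * g x) \<in> sums_of_products"
| sum: "h \<in> sums_of_products \<Longrightarrow> k \<in> sums_of_products \<Longrightarrow> (\<lambda>x. h x + k x) \<in> sums_of_products"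

lemma smooth_mult:
  assumes "smooth f" "smooth g"
  shows "smooth (\<lambda>x. f x * g x)"
proof (rule smooth_coinduct)
  show "(\<lambda>x. f x * g x) \<in> sums_of_products"
    using assms by (rule product)
next
  fix h assume "h \<in> sums_of_products"
  then show "\<exists>h'\<in>sums_of_products. \<forall>x. (h has_vector_derivative h' x) (at x)"
  proof induction
    case (product f g)
    then obtain f' g' where *: "smooth f'" "smooth g'"
        "\<And>x. (f has_vector_derivative f' x) (at x)" "\<And>x. (g has_vector_derivative g' x) (at x)"
      by (metis smooth_derivE)
    then have "(\<lambda>x. f x * g' x + f' x * g x) \<in> sums_of_products"
      using product by (intro sums_of_products.intros)
    with * show ?case
      by (intro bexI[of _ "\<lambda>x. f x * g' x + f' x * g x"]) (auto intro: has_vector_derivative_mult)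
  next
    case (sum h k)
    then obtain h' k' where *: "h' \<in> sums_of_products" "k' \<in> sums_of_products"
        "\<forall>x. (h has_vector_derivative h' x) (at x)" "\<forall>x. (k has_vector_derivative k' x) (at x)"
      by blast
    then have "(\<lambda>x. h' x + k' x) \<in> sums_of_products"
      by (intro sums_of_products.intros)
    with * show ?case
      by (intro bexI[of _ "\<lambda>x. h' x + k' x"]) (auto intro: has_vector_derivative_add)
  qed
qed

lemma smooth_polynomial_function:
  assumes "polynomial_function f"
  shows "smooth f"
proof (rule smooth_coinduct)
  show "f \<in> Collect polynomial_function" using assms by simp
next
  fix g :: "real \<Rightarrow> complex" assume "g \<in> Collect polynomial_function"
  then show "\<exists>g'\<in>Collect polynomial_function. \<forall>x. (g has_vector_derivative g' x) (at x)"
    by (metis has_vector_derivative_polynomial_function mem_Collect_eq)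
qed

lemma smooth_const: "smooth (\<lambda>x. c)"
  by (simp add: smooth_polynomial_function)

lemma smooth_affine:
  assumes "smooth f"
  shows "smooth (\<lambda>x. f (m * x + k))"
proof -
  let ?S = "{\<lambda>x. of_real c * f (m * x + k) | c f. smooth f}"
  have "(\<lambda>x. of_real 1 * f (m * x + k)) \<in> ?S"
    using assms by blast
  then have "smooth (\<lambda>x. of_real 1 * f (m * x + k))"
  proof (rule smooth_coinduct)
    fix h assume "h \<in> ?S"
    then obtain c f where h: "h = (\<lambda>x. of_real c * f (m * x + k))" and "smooth f"
      by blast
    then obtain f' where f': "smooth f'" "\<And>x. (f has_vector_derivative f' x) (at x)"
      by (metis smooth_derivE)
    have "(h has_vector_derivative of_real (c * m) * f' (m * x + k)) (at x)" for x
    proof -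
      have "((\<lambda>x. m * x + k) has_real_derivative m) (at x)"
        by (auto intro!: derivative_eq_intros)
      then have "((f \<circ> (\<lambda>x. m * x + k)) has_vector_derivative m *\<^sub>R f' (m * x + k)) (at x)"
        by (intro vector_diff_chain_at f'(2)) (simp add: has_real_derivative_iff_has_vector_derivative)
      then have "((\<lambda>x. of_real c * (f \<circ> (\<lambda>x. m * x + k)) x) has_vector_derivative
          of_real c * (m *\<^sub>R f' (m * x + k))) (at x)"
        by (rule has_vector_derivative_mult_right)
      then show ?thesis
        unfolding h by (simp add: o_def scaleR_conv_of_real mult.assoc)
    qed
    then show "\<exists>h'\<in>?S. \<forall>x. (h has_vector_derivative h' x) (at x)"
      using f'(1) by (intro bexI[of _ "\<lambda>x. of_real (c * m) * f' (m * x + k)"] CollectI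
          exI[of _ "c * m"] exI[of _ f']) auto
  qed
  then show ?thesis by simp
qed

text \<open>
  The functions \<open>P(1/x) exp(-1/x)\<close> for \<open>x > 0\<close>, extended by zero. The polynomial is a parameter
  because differentiation maps this family to itself, replacing \<open>P\<close> by \<open>y\<^sup>2 (P - P')\<close>. The case
  \<open>P = 1\<close> supplies the cutoff functions.
\<close>

definition flat :: "real poly \<Rightarrow> real \<Rightarrow> real" where
  "flat P x = (if x > 0 then poly P (1 / x) * exp (- (1 / x)) else 0)"

lemma poly_times_exp_tendsto_0:
  fixes P :: "real poly"
  shows "((\<lambda>y. poly P y * exp (- y)) \<longlongrightarrow> 0) at_top"
proof -
  have "((\<lambda>y. \<Sum>i\<le>degree P. coeff P i * (y ^ i / exp y)) \<longlongrightarrow> (\<Sum>i\<le>degree P. coeff P i * 0)) at_top"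
    by (intro tendsto_sum tendsto_mult tendsto_const tendsto_power_div_exp_0)
  then show ?thesis
    by (simp add: poly_altdef sum_distrib_right exp_minus divide_inverse mult.assoc)
qed

lemma flat_has_derivative:
  "(flat P has_real_derivative flat ([:0, 0, 1:] * (P - pderiv P)) x) (at x)"
proof -
  consider "x > 0" | "x < 0" | "x = 0" by linarith
  then show ?thesis
  proof cases
    case 1
    have "((\<lambda>x. poly P (1 / x) * exp (- (1 / x))) has_real_derivative
        poly P (1 / x) * (exp (- (1 / x)) * (1 / x\<^sup>2)) +
        poly (pderiv P) (1 / x) * (- 1 / x\<^sup>2) * exp (- (1 / x))) (at x)"
      using 1 by (intro derivative_eq_intros DERIV_chain2[OF poly_DERIV] refl)
        (auto simp: power2_eq_square)
    moreover have "poly P (1 / x) * (exp (- (1 / x)) * (1 / x\<^sup>2)) +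
        poly (pderiv P) (1 / x) * (- 1 / x\<^sup>2) * exp (- (1 / x)) =
        flat ([:0, 0, 1:] * (P - pderiv P)) x"
      using 1 by (simp add: flat_def power2_eq_square left_diff_distrib right_diff_distrib mult_ac)
    ultimately have "((\<lambda>x. poly P (1 / x) * exp (- (1 / x))) has_real_derivative
        flat ([:0, 0, 1:] * (P - pderiv P)) x) (at x)" by (simp only:)
    then show ?thesis
      by (rule has_field_derivative_transform_within_open[of _ _ _ "{0<..}"])
        (use 1 in \<open>simp_all add: flat_def\<close>)
  next
    case 2
    have "((\<lambda>x. 0) has_real_derivative flat ([:0, 0, 1:] * (P - pderiv P)) x) (at x)"
      using 2 by (simp add: flat_def)
    then show ?thesis
      by (rule has_field_derivative_transform_within_open[of _ _ _ "{..<0}"])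
        (use 2 in \<open>simp_all add: flat_def\<close>)
  next
    case 3
    \<comment> \<open>The substitution \<open>y = 1/h\<close> turns the difference quotient into \<open>y P(y) exp(-y)\<close>.\<close>
    have "((\<lambda>h. flat P h / h) \<longlongrightarrow> 0) (at_right 0)"
    proof -
      have "((\<lambda>h. poly ([:0, 1:] * P) (inverse h) * exp (- inverse h)) \<longlongrightarrow> 0) (at_right (0::real))"
        by (rule filterlim_compose[OF poly_times_exp_tendsto_0 filterlim_inverse_at_top_right])
      then show ?thesis
      proof (rule Lim_transform_eventually)
        show "\<forall>\<^sub>F h in at_right 0. poly ([:0, 1:] * P) (inverse h) * exp (- inverse h) = flat P h / h"
          by (simp add: eventually_at_filter flat_def divide_inverse mult.assoc)
      qed
    qed
    moreover have "((\<lambda>h. flat P h / h) \<longlongrightarrow> 0) (at_left 0)"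
      by (rule tendsto_eventually) (simp add: eventually_at_filter flat_def)
    ultimately have "((\<lambda>h. flat P h / h) \<longlongrightarrow> 0) (at 0)"
      by (simp add: filterlim_at_split)
    then show ?thesis
      using 3 by (simp add: DERIV_def flat_def)
  qed
qed

lemma smooth_flat: "smooth (\<lambda>x. of_real (flat P x))"
proof (rule smooth_coinduct)
  show "(\<lambda>x. complex_of_real (flat P x)) \<in> {\<lambda>x. of_real (flat P x) | P. True}"
    by blast
next
  fix g :: "real \<Rightarrow> complex" assume "g \<in> {\<lambda>x. of_real (flat P x) | P. True}"
  then obtain P where g: "g = (\<lambda>x. of_real (flat P x))" by blast
  have "(g has_vector_derivative of_real (flat ([:0, 0, 1:] * (P - pderiv P)) x)) (at x)" for x
    unfolding g
    using bounded_linear.has_vector_derivative[OF bounded_linear_of_real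
        flat_has_derivative[unfolded has_real_derivative_iff_has_vector_derivative]] by simp
  then show "\<exists>g'\<in>{\<lambda>x. of_real (flat P x) | P. True}. \<forall>x. (g has_vector_derivative g' x) (at x)"
    by (intro bexI[of _ "\<lambda>x. of_real (flat ([:0, 0, 1:] * (P - pderiv P)) x)"]) auto
qed

lemma smooth_continuous: "smooth f \<Longrightarrow> continuous_on S f"
  by (metis continuous_at_imp_continuous_on has_vector_derivative_continuous smooth_derivE)

text \<open>
  A nonempty compact support attains its infimum and its supremum, hence stays away from the end
  points. In this form the support condition is easy to check for sums, products and primitives.
\<close>

lemma C0_infty_iff:
  assumes "a < b"
  shows "f \<in> C0_infty {a<..<b} \<longleftrightarrow>
    smooth f \<and> (\<exists>c d. a < c \<and> c \<le> d \<and> d < b \<and> (\<forall>x. x \<notin> {c..d} \<longrightarrow> f x = 0))"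
proof (intro iffI conjI)
  assume f: "f \<in> C0_infty {a<..<b}"
  then show "smooth f" by (simp add: C0_infty_def)
  let ?K = "closure {x. f x \<noteq> 0}"
  have K: "compact ?K" "?K \<subseteq> {a<..<b}" using f by (auto simp: C0_infty_def)
  show "\<exists>c d. a < c \<and> c \<le> d \<and> d < b \<and> (\<forall>x. x \<notin> {c..d} \<longrightarrow> f x = 0)"
  proof (cases "?K = {}")
    case True
    then have "f x = 0" for x by (simp add: closure_eq_empty)
    moreover have "a < (a + b) / 2" "(a + b) / 2 < b" using assms by simp_all
    ultimately show ?thesis by blast
  next
    case False
    obtain c d where "c \<in> ?K" "d \<in> ?K" and cd: "\<And>x. x \<in> ?K \<Longrightarrow> c \<le> x" "\<And>x. x \<in> ?K \<Longrightarrow> x \<le> d"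
      using compact_attains_inf[OF K(1) False] compact_attains_sup[OF K(1) False] by blast
    moreover have "f x = 0" if "x \<notin> {c..d}" for x
    proof (rule ccontr)
      assume "f x \<noteq> 0"
      then have "x \<in> ?K" by (simp add: closure_subset[THEN subsetD])
      then show False using cd that by auto
    qed
    moreover have "a < c" "c \<le> d" "d < b"
      using K(2) \<open>c \<in> ?K\<close> \<open>d \<in> ?K\<close> cd by (auto simp: subset_iff)
    ultimately show ?thesis by blast
  qed
next
  assume "smooth f \<and> (\<exists>c d. a < c \<and> c \<le> d \<and> d < b \<and> (\<forall>x. x \<notin> {c..d} \<longrightarrow> f x = 0))"
  then obtain c d where cd: "smooth f" "a < c" "d < b" "\<And>x. x \<notin> {c..d} \<Longrightarrow> f x = 0" by blast
  then have "closure {x. f x \<noteq> 0} \<subseteq> {c..d}"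
    by (intro closure_minimal) blast+
  moreover from this have "bounded (closure {x. f x \<noteq> 0})"
    by (rule bounded_subset[OF bounded_closed_interval])
  moreover have "{c..d} \<subseteq> {a<..<b}"
    using cd(2,3) by auto
  ultimately show "f \<in> C0_infty {a<..<b}"
    using cd(1) unfolding C0_infty_def compact_eq_bounded_closed by blast
qed

lemma C0_infty_derivE:
  assumes "a < b" "f \<in> C0_infty {a<..<b}"
  obtains f' where "f' \<in> C0_infty {a<..<b}" "\<And>x. (f has_vector_derivative f' x) (at x)"
proof -
  obtain c d where f: "smooth f" and cd: "a < c" "c \<le> d" "d < b" "\<And>x. x \<notin> {c..d} \<Longrightarrow> f x = 0"
    using assms C0_infty_iff by metis
  obtain f' where f': "smooth f'" "\<And>x. (f has_vector_derivative f' x) (at x)"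
    using f smooth_derivE by blast
  have "f' x = 0" if "x \<notin> {c..d}" for x
  proof -
    have "((\<lambda>_. 0) has_vector_derivative 0) (at x)" by simp
    then have "(f has_vector_derivative 0) (at x)"
      by (rule has_vector_derivative_transform_within_open[of _ _ _ "- {c..d}"]) (use that cd(4) in auto)
    then show ?thesis using f'(2) vector_derivative_unique_at by blast
  qed
  then show thesis using that f' cd assms(1) C0_infty_iff by metis
qed

lemma C0_infty_add:
  assumes "a < b" "f \<in> C0_infty {a<..<b}" "g \<in> C0_infty {a<..<b}"
  shows "(\<lambda>x. f x + g x) \<in> C0_infty {a<..<b}"
proof -
  obtain c d c' d' where f: "smooth f" "a < c" "c \<le> d" "d < b" "\<And>x. x \<notin> {c..d} \<Longrightarrow> f x = 0"
    and g: "smooth g" "a < c'" "c' \<le> d'" "d' < b" "\<And>x. x \<notin> {c'..d'} \<Longrightarrow> g x = 0"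
    using assms C0_infty_iff by metis
  then have "\<forall>x. x \<notin> {min c c'..max d d'} \<longrightarrow> f x + g x = 0"
    by (simp add: not_le)
  then show ?thesis
    using f(1-4) g(1-4) unfolding C0_infty_iff[OF assms(1)]
    by (intro conjI smooth_add exI[of _ "min c c'"] exI[of _ "max d d'"]) simp_all
qed

lemma C0_infty_mult_smooth:
  assumes "a < b" "f \<in> C0_infty {a<..<b}" "smooth g"
  shows "(\<lambda>x. g x * f x) \<in> C0_infty {a<..<b}"
proof -
  obtain c d where f: "smooth f" "a < c" "c \<le> d" "d < b" "\<And>x. x \<notin> {c..d} \<Longrightarrow> f x = 0"
    using assms C0_infty_iff by metis
  then have "\<forall>x. x \<notin> {c..d} \<longrightarrow> g x * f x = 0" by simp
  then show ?thesis
    using f(1-4) unfolding C0_infty_iff[OF assms(1)] by (blast intro: smooth_mult assms(3))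
qed

text \<open>
  Beyond the support of \<open>f\<close> the primitive is constant; it is zero to the left by the choice of the
  base point and zero to the right because the total integral vanishes.
\<close>

lemma C0_infty_antideriv:
  assumes "a < b" "f \<in> C0_infty {a<..<b}" "integral {a..b} f = 0"
  obtains F where "F \<in> C0_infty {a<..<b}" "\<And>x. (F has_vector_derivative f x) (at x)"
proof -
  obtain c d where f: "smooth f" and cd: "a < c" "c \<le> d" "d < b" "\<And>x. x \<notin> {c..d} \<Longrightarrow> f x = 0"
    using assms C0_infty_iff by metis
  have int: "f integrable_on {u..v}" for u v
    by (intro integrable_continuous_real smooth_continuous f)
  define F where "F = (\<lambda>x. integral {a..x} f)"
  have F_left: "F x = 0" if "x < c" for x
    unfolding F_def using that cd(4) by (intro integral_unique has_integral_is_0) simp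
  have F_right: "F x = 0" if "d < x" for x
  proof (cases "x \<le> b")
    case True
    have "integral {x..b} f = 0"
      using that cd(3,4) by (intro integral_unique has_integral_is_0) simp
    then show ?thesis
      using Henstock_Kurzweil_Integration.integral_combine[of a x b f] int assms(3) True that cd(1,2)
      by (simp add: F_def)
  next
    case False
    have "integral {b..x} f = 0"
      using that cd(3,4) by (intro integral_unique has_integral_is_0) simp
    then show ?thesis
      using Henstock_Kurzweil_Integration.integral_combine[of a b x f] int assms(1,3) False
      by (simp add: F_def)
  qed
  have deriv: "(F has_vector_derivative f x) (at x)" for x
  proof (cases "x < c")
    case True
    have "((\<lambda>_. 0) has_vector_derivative f x) (at x)" using True cd(4)[of x] by simp
    then show ?thesis
      by (rule has_vector_derivative_transform_within_open[of _ _ _ "{..<c}"]) (use True F_left in simp_all)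
  next
    case False
    have "(F has_vector_derivative f x) (at x within {a..x+1})"
      unfolding F_def
      by (rule integral_has_vector_derivative) (use False cd(1) in \<open>simp_all add: smooth_continuous f\<close>)
    moreover have "x \<in> interior {a..x+1}" using False cd(1) by simp
    ultimately show ?thesis by (simp only: at_within_interior)
  qed
  have "smooth F"
  proof (rule smooth_coinduct)
    show "F \<in> insert F (Collect smooth)" by simp
    fix g assume "g \<in> insert F (Collect smooth)"
    then consider "g = F" | "smooth g" by blast
    then show "\<exists>g'\<in>insert F (Collect smooth). \<forall>x. (g has_vector_derivative g' x) (at x)"
    proof cases
      case 1
      then show ?thesis using deriv f by (intro bexI[of _ f]) simp_all
    next
      case 2
      then obtain g' where "smooth g'" "\<And>x. (g has_vector_derivative g' x) (at x)"
        by (rule smooth_derivE) blast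
      then show ?thesis by (intro bexI[of _ g']) simp_all
    qed
  qed
  moreover have "\<forall>x. x \<notin> {c..d} \<longrightarrow> F x = 0"
    using F_left F_right by (simp add: linorder_not_le)
  ultimately have "F \<in> C0_infty {a<..<b}"
    using cd(1-3) unfolding C0_infty_iff[OF assms(1)] by blast
  then show thesis using deriv by (rule that)
qed

section \<open>Square-integrable functions on a bounded interval\<close>

locale bounded_interval =
  fixes a b :: real
  assumes a_less_b: "a < b"
begin

abbreviation "I \<equiv> {a<..<b}"
abbreviation "M \<equiv> lebesgue_on {a<..<b}"

sublocale M: finite_measure M
proof
  show "emeasure M (space M) \<noteq> \<infinity>"
    using a_less_b by (simp add: emeasure_restrict_space)
qed

lemma measure_interval: "measure M (space M) = b - a"
  using a_less_b by (simp add: measure_restrict_space)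

lemma L2_measurable: "f \<in> L2 I \<Longrightarrow> f \<in> borel_measurable M"
  and L2_integrable_square: "f \<in> L2 I \<Longrightarrow> integrable M (\<lambda>x. (cmod (f x))\<^sup>2)"
  by (simp_all add: L2_def)

lemma L2_dominated:
  assumes "f \<in> borel_measurable M" "integrable M w" "AE x in M. (cmod (f x))\<^sup>2 \<le> w x"
  shows "f \<in> L2 I"
proof -
  have "integrable M (\<lambda>x. (cmod (f x))\<^sup>2)"
  proof (rule Bochner_Integration.integrable_bound[OF assms(2)])
    show "(\<lambda>x. (cmod (f x))\<^sup>2) \<in> borel_measurable M"
      using assms(1) by measurable
    show "AE x in M. norm ((cmod (f x))\<^sup>2) \<le> norm (w x)"
      using assms(3) by eventually_elim simp
  qed
  then show ?thesis
    using assms(1) by (simp add: L2_def)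
qed

lemma L2_bounded:
  assumes "f \<in> borel_measurable M" "AE x in M. cmod (f x) \<le> C"
  shows "f \<in> L2 I"
proof (rule L2_dominated[OF assms(1)])
  show "integrable M (\<lambda>x. C\<^sup>2)" by simp
  show "AE x in M. (cmod (f x))\<^sup>2 \<le> C\<^sup>2"
    using assms(2) by eventually_elim (auto intro: power_mono)
qed

lemma L2_const: "(\<lambda>x. c) \<in> L2 I"
  by (rule L2_bounded[of _ "cmod c"]) auto

lemma L2_cmult: 
  assumes "f \<in> L2 I"
  shows "(\<lambda>x. c * f x) \<in> L2 I"
proof (rule L2_dominated)
  show "integrable M (\<lambda>x. (cmod c)\<^sup>2 * (cmod (f x))\<^sup>2)"
    using L2_integrable_square[OF assms] by simp
  show "(\<lambda>x. c * f x) \<in> borel_measurable M"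
    using L2_measurable[OF assms] by measurable
qed (simp add: norm_mult power_mult_distrib)

lemma L2_bounded_mult: 
  assumes "f \<in> L2 I" "g \<in> borel_measurable M" "AE x in M. cmod (g x) \<le> C"
  shows "(\<lambda>x. g x * f x) \<in> L2 I"
proof (rule L2_dominated)
  show "integrable M (\<lambda>x. C\<^sup>2 * (cmod (f x))\<^sup>2)"
    using L2_integrable_square[OF assms(1)] by simp
  show "(\<lambda>x. g x * f x) \<in> borel_measurable M"
    using L2_measurable[OF assms(1)] assms(2) by measurable
  show "AE x in M. (cmod (g x * f x))\<^sup>2 \<le> C\<^sup>2 * (cmod (f x))\<^sup>2"
    using assms(3) by eventually_elim (auto simp: norm_mult power_mult_distrib intro!: mult_right_mono power_mono)
qed

lemma L2_add: 
  assumes "f \<in> L2 I" "g \<in> L2 I"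
  shows "(\<lambda>x. f x + g x) \<in> L2 I"
proof (rule L2_dominated)
  show "integrable M (\<lambda>x. 2 * (cmod (f x))\<^sup>2 + 2 * (cmod (g x))\<^sup>2)"
    using L2_integrable_square[OF assms(1)] L2_integrable_square[OF assms(2)] by simp
  show "(\<lambda>x. f x + g x) \<in> borel_measurable M"
    using L2_measurable[OF assms(1)] L2_measurable[OF assms(2)] by measurable
  have "(cmod (f x + g x))\<^sup>2 \<le> 2 * (cmod (f x))\<^sup>2 + 2 * (cmod (g x))\<^sup>2" for x
  proof -
    have "(cmod (f x + g x))\<^sup>2 \<le> (cmod (f x) + cmod (g x))\<^sup>2"
      by (intro power_mono norm_triangle_ineq norm_ge_zero)
    also have "\<dots> \<le> 2 * (cmod (f x))\<^sup>2 + 2 * (cmod (g x))\<^sup>2"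
      using zero_le_power2[of "cmod (f x) - cmod (g x)"] by (simp add: power2_sum power2_diff)
    finally show ?thesis .
  qed
  then show "AE x in M. (cmod (f x + g x))\<^sup>2 \<le> 2 * (cmod (f x))\<^sup>2 + 2 * (cmod (g x))\<^sup>2"
    by simp
qed

lemma L2_uminus: "f \<in> L2 I \<Longrightarrow> (\<lambda>x. - f x) \<in> L2 I"
  using L2_cmult[of f "-1"] by simp

lemma L2_diff: "f \<in> L2 I \<Longrightarrow> g \<in> L2 I \<Longrightarrow> (\<lambda>x. f x - g x) \<in> L2 I"
  using L2_add[OF _ L2_uminus, of f g] by simp

lemma L2_cnj: "f \<in> L2 I \<Longrightarrow> (\<lambda>x. cnj (f x)) \<in> L2 I"
  unfolding L2_def by (auto intro: borel_measurable_continuous_on[OF continuous_on_cnj[OF continuous_on_id]])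

lemma L2_norm_nonneg: "0 \<le> L2_norm I f"
  by (simp add: L2_norm_def)

lemma L2_norm_square: "(L2_norm I f)\<^sup>2 = (LINT x|M. (cmod (f x))\<^sup>2)"
  by (simp add: L2_norm_def)

lemma L2_norm_cong: "AE x in M. cmod (f x) = cmod (g x) \<Longrightarrow>
    f \<in> borel_measurable M \<Longrightarrow> g \<in> borel_measurable M \<Longrightarrow> L2_norm I f = L2_norm I g"
  unfolding L2_norm_def by (intro arg_cong[where f = sqrt] integral_cong_AE) auto

lemma L2_norm_eq_0:
  assumes "f \<in> L2 I" "L2_norm I f = 0"
  shows "AE x in M. f x = 0"
proof -
  have "(LINT x|M. (cmod (f x))\<^sup>2) = 0"
    using assms(2) by (simp flip: L2_norm_square)
  then have "AE x in M. (cmod (f x))\<^sup>2 = 0"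
    by (subst (asm) integral_nonneg_eq_0_iff_AE[OF L2_integrable_square[OF assms(1)]]) auto
  then show ?thesis by simp
qed

lemma L2_integrable_mult_norm:
  assumes "f \<in> L2 I" "g \<in> L2 I"
  shows "integrable M (\<lambda>x. cmod (f x) * cmod (g x))"
proof (rule Bochner_Integration.integrable_bound)
  show "integrable M (\<lambda>x. (cmod (f x))\<^sup>2 + (cmod (g x))\<^sup>2)"
    using assms[THEN L2_integrable_square] by simp
  show "(\<lambda>x. cmod (f x) * cmod (g x)) \<in> borel_measurable M"
    using assms[THEN L2_measurable] by measurable
  have "cmod (f x) * cmod (g x) \<le> (cmod (f x))\<^sup>2 + (cmod (g x))\<^sup>2" for x
  proof -
    have "2 * (cmod (f x) * cmod (g x)) \<le> (cmod (f x))\<^sup>2 + (cmod (g x))\<^sup>2"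
      using zero_le_power2[of "cmod (f x) - cmod (g x)"] by (simp add: power2_diff)
    then show ?thesis
      using mult_nonneg_nonneg[OF norm_ge_zero norm_ge_zero, of "f x" "g x"] by linarith
  qed
  then show "AE x in M. norm (cmod (f x) * cmod (g x)) \<le> norm ((cmod (f x))\<^sup>2 + (cmod (g x))\<^sup>2)"
    by simp
qed

lemma L2_integrable_mult:
  assumes "f \<in> L2 I" "g \<in> L2 I"
  shows "integrable M (\<lambda>x. f x * g x)"
proof (rule Bochner_Integration.integrable_bound[OF L2_integrable_mult_norm[OF assms]])
  show "(\<lambda>x. f x * g x) \<in> borel_measurable M"
    using assms[THEN L2_measurable] by measurable
qed (simp add: norm_mult)

lemma L2_integrable: "f \<in> L2 I \<Longrightarrow> integrable M f"
  using L2_integrable_mult[OF _ L2_const[of 1]] by simp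

text \<open>
  Weighted arithmetic-geometric mean inequality: with \<open>A = \<parallel>f\<parallel>\<close> and \<open>B = \<parallel>g\<parallel>\<close> the pointwise bound
  \<open>|f| |g| \<le> (B/2A) |f|\<^sup>2 + (A/2B) |g|\<^sup>2\<close> integrates to \<open>A B\<close>. If one of the norms is zero, the
  product vanishes almost everywhere.
\<close>

lemma Cauchy_Schwarz_norm:
  assumes "f \<in> L2 I" "g \<in> L2 I"
  shows "(LINT x|M. cmod (f x) * cmod (g x)) \<le> L2_norm I f * L2_norm I g"
proof -
  define A where "A = L2_norm I f"
  define B where "B = L2_norm I g"
  consider "A = 0" | "B = 0" | "A > 0" "B > 0"
    using L2_norm_nonneg[of f] L2_norm_nonneg[of g] by (fastforce simp: A_def B_def)
  then show ?thesis
  proof cases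
    case 1
    then have "AE x in M. cmod (f x) * cmod (g x) = 0"
      using L2_norm_eq_0[OF assms(1)] by (auto simp: A_def elim!: eventually_mono)
    then show ?thesis
      using 1 by (simp add: A_def integral_eq_zero_AE)
  next
    case 2
    then have "AE x in M. cmod (f x) * cmod (g x) = 0"
      using L2_norm_eq_0[OF assms(2)] by (auto simp: B_def elim!: eventually_mono)
    then show ?thesis
      using 2 by (simp add: B_def integral_eq_zero_AE)
  next
    case 3
    have "(LINT x|M. cmod (f x) * cmod (g x)) \<le>
        (LINT x|M. B / (2 * A) * (cmod (f x))\<^sup>2 + A / (2 * B) * (cmod (g x))\<^sup>2)"
    proof (rule integral_mono[OF L2_integrable_mult_norm[OF assms]])
      show "integrable M (\<lambda>x. B / (2 * A) * (cmod (f x))\<^sup>2 + A / (2 * B) * (cmod (g x))\<^sup>2)"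
        using assms[THEN L2_integrable_square] by simp
      fix x
      have "0 \<le> (B * cmod (f x) - A * cmod (g x))\<^sup>2 / (2 * A * B)"
        using 3 by simp
      also have "\<dots> = B / (2 * A) * (cmod (f x))\<^sup>2 + A / (2 * B) * (cmod (g x))\<^sup>2 - cmod (f x) * cmod (g x)"
        using 3 by (simp add: field_simps power2_eq_square)
      finally show "cmod (f x) * cmod (g x) \<le>
          B / (2 * A) * (cmod (f x))\<^sup>2 + A / (2 * B) * (cmod (g x))\<^sup>2" by simp
    qed
    also have "\<dots> = B / (2 * A) * A\<^sup>2 + A / (2 * B) * B\<^sup>2"
      using assms[THEN L2_integrable_square] by (simp add: A_def B_def L2_norm_square)
    also have "\<dots> = A * B"
      using 3 by (simp add: field_simps power2_eq_square)
    finally show ?thesis by (simp add: A_def B_def)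
  qed
qed

lemma L2_norm_triangle:
  assumes "f \<in> L2 I" "g \<in> L2 I"
  shows "L2_norm I (\<lambda>x. f x + g x) \<le> L2_norm I f + L2_norm I g"
proof (rule power2_le_imp_le)
  have "(L2_norm I (\<lambda>x. f x + g x))\<^sup>2 \<le>
      (LINT x|M. (cmod (f x))\<^sup>2 + (cmod (g x))\<^sup>2 + 2 * (cmod (f x) * cmod (g x)))"
    unfolding L2_norm_square
  proof (rule integral_mono)
    show "integrable M (\<lambda>x. (cmod (f x))\<^sup>2 + (cmod (g x))\<^sup>2 + 2 * (cmod (f x) * cmod (g x)))"
      using assms[THEN L2_integrable_square] L2_integrable_mult_norm[OF assms] by simp
    show "integrable M (\<lambda>x. (cmod (f x + g x))\<^sup>2)"
      by (intro L2_integrable_square L2_add assms)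
    fix x
    have "(cmod (f x + g x))\<^sup>2 \<le> (cmod (f x) + cmod (g x))\<^sup>2"
      by (intro power_mono norm_triangle_ineq norm_ge_zero)
    then show "(cmod (f x + g x))\<^sup>2 \<le> (cmod (f x))\<^sup>2 + (cmod (g x))\<^sup>2 + 2 * (cmod (f x) * cmod (g x))"
      by (simp add: power2_sum)
  qed
  also have "\<dots> = (L2_norm I f)\<^sup>2 + (L2_norm I g)\<^sup>2 + 2 * (LINT x|M. cmod (f x) * cmod (g x))"
    using assms[THEN L2_integrable_square] L2_integrable_mult_norm[OF assms]
    by (simp add: L2_norm_square)
  also have "\<dots> \<le> (L2_norm I f + L2_norm I g)\<^sup>2"
    using Cauchy_Schwarz_norm[OF assms] by (simp add: power2_sum)
  finally show "(L2_norm I (\<lambda>x. f x + g x))\<^sup>2 \<le> (L2_norm I f + L2_norm I g)\<^sup>2" .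
qed (simp add: L2_norm_nonneg)

lemma L2_norm_triangle_diff:
  assumes "f \<in> L2 I" "g \<in> L2 I" "h \<in> L2 I"
  shows "L2_norm I (\<lambda>x. f x - h x) \<le> L2_norm I (\<lambda>x. f x - g x) + L2_norm I (\<lambda>x. g x - h x)"
  using L2_norm_triangle[OF L2_diff[OF assms(1,2)] L2_diff[OF assms(2,3)]] by simp

lemma L2_norm_cmult: "L2_norm I (\<lambda>x. c * f x) = cmod c * L2_norm I f"
  by (simp add: L2_norm_def norm_mult power_mult_distrib real_sqrt_mult)

lemma L2_norm_const: "L2_norm I (\<lambda>x. c) = cmod c * sqrt (b - a)"
  using measure_interval by (simp add: L2_norm_def real_sqrt_mult mult.commute)

lemma L2_norm_le_bound:
  assumes "f \<in> L2 I" "AE x in M. cmod (f x) \<le> C" "0 \<le> C"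
  shows "L2_norm I f \<le> C * sqrt (b - a)"
proof -
  have "(LINT x|M. (cmod (f x))\<^sup>2) \<le> (LINT x|M. C\<^sup>2)"
  proof (rule integral_mono_AE)
    show "AE x in M. (cmod (f x))\<^sup>2 \<le> C\<^sup>2"
      using assms(2) by eventually_elim (auto intro: power_mono)
  qed (simp_all add: L2_integrable_square[OF assms(1)])
  then have "L2_norm I f \<le> sqrt (LINT x|M. C\<^sup>2)"
    by (simp add: L2_norm_def)
  also have "\<dots> = C * sqrt (b - a)"
    using measure_interval assms(3) by (simp add: real_sqrt_mult mult.commute)
  finally show ?thesis .
qed

lemma L1_le_L2_norm:
  assumes "f \<in> L2 I"
  shows "(LINT x|M. cmod (f x)) \<le> sqrt (b - a) * L2_norm I f"
  using Cauchy_Schwarz_norm[OF assms L2_const[of 1]] by (simp add: L2_norm_const mult.commute)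

lemma norm_integral_le_L2_norm:
  assumes "f \<in> L2 I"
  shows "cmod (LINT x|M. f x) \<le> sqrt (b - a) * L2_norm I f"
  using L1_le_L2_norm[OF assms] integral_norm_bound[of M f] by linarith

lemma L2_inner_integrable:
  assumes "f \<in> L2 I" "g \<in> L2 I"
  shows "integrable M (\<lambda>x. f x * cnj (g x))"
  by (intro L2_integrable_mult L2_cnj assms)

lemma L2_inner_diff_left:
  assumes "f \<in> L2 I" "g \<in> L2 I" "h \<in> L2 I"
  shows "L2_inner I (\<lambda>x. f x - g x) h = L2_inner I f h - L2_inner I g h"
  unfolding L2_inner_def using assms by (simp add: left_diff_distrib L2_inner_integrable)

lemma L2_inner_diff_right:
  assumes "f \<in> L2 I" "g \<in> L2 I" "h \<in> L2 I"
  shows "L2_inner I f (\<lambda>x. g x - h x) = L2_inner I f g - L2_inner I f h"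
  unfolding L2_inner_def using assms by (simp add: right_diff_distrib L2_inner_integrable)

lemma L2_inner_self: "L2_inner I f f = of_real ((L2_norm I f)\<^sup>2)"
  unfolding L2_inner_def L2_norm_square complex_norm_square[symmetric] by (simp flip: of_real_power)

lemma L2_Cauchy_Schwarz:
  assumes "f \<in> L2 I" "g \<in> L2 I"
  shows "cmod (L2_inner I f g) \<le> L2_norm I f * L2_norm I g"
  using Cauchy_Schwarz_norm[OF assms] integral_norm_bound[of M "\<lambda>x. f x * cnj (g x)"]
  by (simp add: L2_inner_def norm_mult)

lemma L2_inner_cong:
  assumes "AE x in M. f x = f' x" "AE x in M. g x = g' x"
    "f \<in> L2 I" "g \<in> L2 I" "f' \<in> L2 I" "g' \<in> L2 I"
  shows "L2_inner I f g = L2_inner I f' g'"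
  unfolding L2_inner_def
  using assms(1,2) L2_inner_integrable[OF assms(3,4)] L2_inner_integrable[OF assms(5,6)]
  by (intro integral_cong_AE) auto

text \<open>
  The form in which density shows that a function vanishes: if \<open>d\<close> is close to \<open>w\<close> and orthogonal to it, then
  \<open>\<parallel>w\<parallel>\<^sup>2 = \<langle>w - d, w\<rangle> \<le> \<parallel>w - d\<parallel> \<parallel>w\<parallel>\<close>.
\<close>

lemma AE_zero_if_orthogonal_to_approximants:
  assumes "w \<in> L2 I"
    and "\<And>e. e > 0 \<Longrightarrow> \<exists>d\<in>L2 I. L2_norm I (\<lambda>x. w x - d x) < e \<and> L2_inner I d w = 0"
  shows "AE x in M. w x = 0"
proof (rule L2_norm_eq_0[OF assms(1)], rule ccontr)
  assume "L2_norm I w \<noteq> 0"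
  then have pos: "L2_norm I w > 0"
    using L2_norm_nonneg[of w] by simp
  obtain d where d: "d \<in> L2 I" "L2_norm I (\<lambda>x. w x - d x) < L2_norm I w" "L2_inner I d w = 0"
    using assms(2)[OF pos] by blast
  have "(L2_norm I w)\<^sup>2 = cmod (L2_inner I (\<lambda>x. w x - d x) w)"
    using d assms(1) L2_norm_nonneg[of w] by (simp add: L2_inner_diff_left L2_inner_self norm_power)
  also have "\<dots> \<le> L2_norm I (\<lambda>x. w x - d x) * L2_norm I w"
    by (intro L2_Cauchy_Schwarz L2_diff d assms(1))
  also have "\<dots> < L2_norm I w * L2_norm I w"
    using d(2) pos by simp
  finally show False by (simp add: power2_eq_square)
qed

lemma L2_norm_dominated_convergence:
  assumes "f \<in> borel_measurable M" "\<And>n. g n \<in> borel_measurable M" "integrable M w"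
    and "\<And>n. AE x in M. (cmod (f x - g n x))\<^sup>2 \<le> w x"
    and "AE x in M. (\<lambda>n. g n x) \<longlonglongrightarrow> f x"
  shows "(\<lambda>n. L2_norm I (\<lambda>x. f x - g n x)) \<longlonglongrightarrow> 0"
proof -
  have "(\<lambda>n. LINT x|M. (cmod (f x - g n x))\<^sup>2) \<longlonglongrightarrow> (LINT x|M. 0)"
  proof (rule integral_dominated_convergence[where w = w])
    show "(\<lambda>x. (cmod (f x - g n x))\<^sup>2) \<in> borel_measurable M" for n
      using assms(1,2) by measurable
    show "AE x in M. (\<lambda>n. (cmod (f x - g n x))\<^sup>2) \<longlonglongrightarrow> 0"
      using assms(5)
    proof eventually_elim
      case (elim x)
      then have "(\<lambda>n. (cmod (f x - g n x))\<^sup>2) \<longlonglongrightarrow> (cmod (f x - f x))\<^sup>2"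
        by (intro tendsto_intros)
      then show ?case by simp
    qed
  qed (use assms in auto)
  from tendsto_real_sqrt[OF this] show ?thesis by (simp add: L2_norm_def)
qed

section \<open>Density of the test functions\<close>

text \<open>
  Smooth functions that increase to one on the whole interval. The shift by one pushes the support
  into the compact interval of points at distance at least \<open>1/(n+1)\<close> from the end points, and
  \<open>Suc n\<close> avoids a vanishing scaling factor.
\<close>

definition cutoff :: "nat \<Rightarrow> real \<Rightarrow> real" where
  "cutoff n x = flat 1 (Suc n * (x - a) - 1) * flat 1 (Suc n * (b - x) - 1)"

lemma cutoff_bounds: "0 \<le> cutoff n x" "cutoff n x \<le> 1"
  by (auto simp: cutoff_def flat_def mult_le_one)

lemma cutoff_C0_infty: "(\<lambda>x. of_real (cutoff n x)) \<in> C0_infty I"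
proof -
  \<comment> \<open>For small \<open>n\<close> the support is empty; the midpoint keeps the enclosing interval nonempty.\<close>
  let ?m = "(a + b) / 2" and ?h = "1 / real (Suc n)"
  have "smooth (\<lambda>x. of_real (flat 1 (real (Suc n) * x + (- real (Suc n) * a - 1))) *
      of_real (flat 1 ((- real (Suc n)) * x + (real (Suc n) * b - 1))))"
    using smooth_mult[OF smooth_affine[OF smooth_flat] smooth_affine[OF smooth_flat]] .
  moreover have "(\<lambda>x. of_real (flat 1 (real (Suc n) * x + (- real (Suc n) * a - 1))) *
      of_real (flat 1 ((- real (Suc n)) * x + (real (Suc n) * b - 1)))) = (\<lambda>x. complex_of_real (cutoff n x))"
    by (simp add: cutoff_def algebra_simps)
  ultimately have "smooth (\<lambda>x. of_real (cutoff n x))" by (simp only:)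
  moreover have "complex_of_real (cutoff n x) = 0" if "x \<notin> {min ?m (a + ?h)..max ?m (b - ?h)}" for x
  proof -
    have "x < a + ?h \<or> b - ?h < x" using that by auto
    then have "Suc n * (x - a) - 1 < 0 \<or> Suc n * (b - x) - 1 < 0"
      by (auto simp: field_simps)
    then show ?thesis by (auto simp: cutoff_def flat_def)
  qed
  moreover have "a < min ?m (a + ?h)" "max ?m (b - ?h) < b" "min ?m (a + ?h) \<le> max ?m (b - ?h)"
    using a_less_b by simp_all
  ultimately show ?thesis
    unfolding C0_infty_iff[OF a_less_b] by blast
qed

lemma cutoff_tendsto_1:
  assumes "x \<in> I"
  shows "(\<lambda>n. cutoff n x) \<longlonglongrightarrow> 1"
proof -
  have *: "(\<lambda>n. flat 1 (real (Suc n) * t - 1)) \<longlonglongrightarrow> 1" if "t > 0" for t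
  proof -
    have lim: "filterlim (\<lambda>n. real (Suc n) * t - 1) at_top sequentially"
      using that
      by (intro filterlim_tendsto_add_at_top[OF tendsto_const, where c = "-1", simplified]
          filterlim_at_top_mult_tendsto_pos[OF tendsto_const that]
          filterlim_compose[OF filterlim_real_sequentially filterlim_Suc])
    have "((\<lambda>y. flat 1 y) \<longlongrightarrow> 1) at_top"
    proof (rule Lim_transform_eventually)
      show "((\<lambda>y::real. exp (- (1 / y))) \<longlongrightarrow> 1) at_top"
      proof -
        have "((\<lambda>y::real. exp (- inverse y)) \<longlongrightarrow> exp (- 0)) at_top"
          by (intro tendsto_exp tendsto_minus tendsto_inverse_0_at_top filterlim_ident)
        then show ?thesis by (simp add: inverse_eq_divide)
      qed
      show "\<forall>\<^sub>F y in at_top. exp (- (1 / y)) = flat 1 y"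
        using eventually_gt_at_top[of 0] by eventually_elim (simp add: flat_def)
    qed
    from filterlim_compose[OF this lim] show ?thesis .
  qed
  show ?thesis
    using tendsto_mult[OF *[of "x - a"] *[of "b - x"]] assms by (simp add: cutoff_def)
qed

lemma AE_interval: "(\<And>x. x \<in> I \<Longrightarrow> P x) \<Longrightarrow> AE x in M. P x"
  by (rule AE_I2) simp

lemma AE_interval_not_in:
  assumes "negligible N"
  shows "AE x in M. x \<notin> N"
proof -
  have "AE x in lebesgue. x \<notin> N"
    using assms by (intro AE_not_in) (simp add: negligible_iff_null_sets)
  then have "AE x in lebesgue. x \<in> I \<longrightarrow> x \<notin> N"
    by eventually_elim simp
  then show ?thesis
    by (subst AE_restrict_space_iff) simp_all
qed

lemma L2_continuous:
  assumes "continuous_on {a..b} f"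
  shows "f \<in> L2 I"
proof -
  have "continuous_on I f"
    by (rule continuous_on_subset[OF assms]) auto
  then have "f \<in> borel_measurable M"
    by (rule continuous_imp_measurable_on_sets_lebesgue) simp
  moreover have "compact (f ` {a..b})"
    using assms by (intro compact_continuous_image compact_Icc)
  then obtain C where "\<forall>z\<in>f ` {a..b}. cmod z \<le> C"
    using compact_imp_bounded bounded_iff by metis
  then have "AE x in M. cmod (f x) \<le> C"
    by (intro AE_interval) simp
  ultimately show ?thesis by (rule L2_bounded)
qed

lemma L2_C0_infty:
  assumes "f \<in> C0_infty I"
  shows "f \<in> L2 I"
  using assms unfolding C0_infty_iff[OF a_less_b]
  by (intro L2_continuous smooth_continuous) blast

text \<open>
  The \<open>L\<^sup>2\<close>-closure of the test functions. It is shown to be everything by climbing from polynomials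
  (cut off near the end points) to continuous functions (Weierstrass), to bounded measurable
  functions (almost everywhere limits of continuous ones), and finally to all of \<open>L\<^sup>2\<close>.
\<close>

definition approximable :: "(real \<Rightarrow> complex) \<Rightarrow> bool" where
  "approximable f \<longleftrightarrow> f \<in> L2 I \<and> (\<forall>e>0. \<exists>\<phi>\<in>C0_infty I. L2_norm I (\<lambda>x. f x - \<phi> x) < e)"

lemma approximable_C0_infty: "f \<in> C0_infty I \<Longrightarrow> approximable f"
  unfolding approximable_def using L2_norm_const[of 0]
  by (intro conjI allI impI bexI[of _ f] L2_C0_infty) simp_all

lemma approximable_limit:
  assumes "f \<in> L2 I" "\<And>n. approximable (g n)" "(\<lambda>n. L2_norm I (\<lambda>x. f x - g n x)) \<longlonglongrightarrow> 0"
  shows "approximable f"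
  unfolding approximable_def
proof (intro conjI allI impI assms(1))
  fix e :: real assume "e > 0"
  then have "\<forall>\<^sub>F n in sequentially. L2_norm I (\<lambda>x. f x - g n x) < e / 2"
    by (intro order_tendstoD(2)[OF assms(3)]) simp
  then obtain n where n: "L2_norm I (\<lambda>x. f x - g n x) < e / 2"
    using eventually_happens'[OF sequentially_bot] by blast
  have g: "g n \<in> L2 I" "\<forall>e>0. \<exists>\<phi>\<in>C0_infty I. L2_norm I (\<lambda>x. g n x - \<phi> x) < e"
    using assms(2)[of n] by (auto simp: approximable_def)
  then obtain \<phi> where \<phi>: "\<phi> \<in> C0_infty I" "L2_norm I (\<lambda>x. g n x - \<phi> x) < e / 2"
    using half_gt_zero[OF \<open>e > 0\<close>] by blast
  then have "L2_norm I (\<lambda>x. f x - \<phi> x) < e"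
    using L2_norm_triangle_diff[OF assms(1) g(1) L2_C0_infty[OF \<phi>(1)]] n by linarith
  then show "\<exists>\<phi>\<in>C0_infty I. L2_norm I (\<lambda>x. f x - \<phi> x) < e"
    using \<phi>(1) by blast
qed

lemma approximable_polynomial:
  assumes "polynomial_function f"
  shows "approximable f"
proof (rule approximable_limit)
  have smooth: "smooth f" by (rule smooth_polynomial_function[OF assms])
  show L2: "f \<in> L2 I" by (intro L2_continuous smooth_continuous smooth)
  have C0: "(\<lambda>x. f x * of_real (cutoff n x)) \<in> C0_infty I" for n
    by (intro C0_infty_mult_smooth a_less_b cutoff_C0_infty smooth)
  show "approximable (\<lambda>x. f x * of_real (cutoff n x))" for n
    by (intro approximable_C0_infty C0)
  show "(\<lambda>n. L2_norm I (\<lambda>x. f x - f x * of_real (cutoff n x))) \<longlonglongrightarrow> 0"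
  proof (rule L2_norm_dominated_convergence)
    show "f \<in> borel_measurable M" "\<And>n. (\<lambda>x. f x * of_real (cutoff n x)) \<in> borel_measurable M"
      by (intro L2_measurable L2 L2_C0_infty C0)+
    show "integrable M (\<lambda>x. (cmod (f x))\<^sup>2)"
      by (intro L2_integrable_square L2)
    have "cmod (f x - f x * of_real (cutoff n x)) \<le> cmod (f x)" for n x
    proof -
      have "f x - f x * of_real (cutoff n x) = f x * of_real (1 - cutoff n x)"
        by (simp add: algebra_simps)
      then have "cmod (f x - f x * of_real (cutoff n x)) = cmod (f x) * (1 - cutoff n x)"
        using cutoff_bounds[where n = n and x = x] by (simp add: norm_mult del: of_real_diff)
      then show ?thesis
        using cutoff_bounds[where n = n and x = x] by (simp add: mult_left_le)
    qed
    then show "AE x in M. (cmod (f x - f x * of_real (cutoff n x)))\<^sup>2 \<le> (cmod (f x))\<^sup>2" for n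
      by (intro AE_I2 power_mono) simp_all
    show "AE x in M. (\<lambda>n. f x * of_real (cutoff n x)) \<longlonglongrightarrow> f x"
    proof (rule AE_interval)
      fix x assume "x \<in> I"
      then have "(\<lambda>n. f x * of_real (cutoff n x)) \<longlonglongrightarrow> f x * of_real 1"
        by (intro tendsto_mult tendsto_const tendsto_of_real cutoff_tendsto_1)
      then show "(\<lambda>n. f x * of_real (cutoff n x)) \<longlonglongrightarrow> f x" by simp
    qed
  qed
qed

lemma approximable_continuous:
  assumes "continuous_on {a..b} f"
  shows "approximable f"
proof -
  have L2: "f \<in> L2 I" by (rule L2_continuous[OF assms])
  have "\<exists>g. polynomial_function g \<and> (\<forall>x\<in>{a..b}. cmod (f x - g x) < 1 / Suc n)" for n
    by (rule Stone_Weierstrass_polynomial_function[OF compact_Icc assms]) simp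
  then obtain g where g: "\<And>n. polynomial_function (g n)"
      "\<And>n x. x \<in> {a..b} \<Longrightarrow> cmod (f x - g n x) < 1 / Suc n"
    by metis
  then have appr: "approximable (g n)" for n
    by (intro approximable_polynomial)
  have "(\<lambda>n. L2_norm I (\<lambda>x. f x - g n x)) \<longlonglongrightarrow> 0"
  proof (rule tendsto_sandwich[of "\<lambda>_. 0"])
    show "(\<lambda>n. 1 / Suc n * sqrt (b - a)) \<longlonglongrightarrow> 0"
      using tendsto_mult_left_zero[OF LIMSEQ_Suc[OF lim_1_over_n]] by blast
    have "L2_norm I (\<lambda>x. f x - g n x) \<le> 1 / Suc n * sqrt (b - a)" for n
    proof (rule L2_norm_le_bound)
      show "(\<lambda>x. f x - g n x) \<in> L2 I"
        using L2 appr[of n] by (intro L2_diff) (simp_all add: approximable_def)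
      show "AE x in M. cmod (f x - g n x) \<le> 1 / real (Suc n)"
        by (intro AE_interval less_imp_le g(2)) simp
    qed simp
    then show "\<forall>\<^sub>F n in sequentially. L2_norm I (\<lambda>x. f x - g n x) \<le> 1 / Suc n * sqrt (b - a)"
      by simp
  qed (simp_all add: L2_norm_nonneg)
  then show ?thesis by (rule approximable_limit[OF L2 appr])
qed

text \<open>
  A measurable function is almost everywhere a limit of continuous functions. Projecting these onto
  the disc of radius \<open>C\<close> keeps them continuous, does not change the limit and makes the convergence
  dominated.
\<close>

lemma approximable_bounded:
  assumes "f \<in> borel_measurable M" "\<And>x. cmod (f x) \<le> C"
  shows "approximable f"
proof -
  have "0 \<le> C" using assms(2)[of 0] norm_ge_zero[of "f 0"] by linarith
  let ?T = "closest_point (cball (0 :: complex) C)"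
  have T: "cmod (?T z) \<le> C" for z
    using closest_point_in_set[of "cball 0 C" z] \<open>0 \<le> C\<close> by simp
  have T_f: "?T (f x) = f x" for x
    using assms(2) by (intro closest_point_self) simp
  have T_cont: "continuous_on S ?T" for S
    using \<open>0 \<le> C\<close> by (intro continuous_on_closest_point) auto
  have "(\<lambda>x. if x \<in> I then f x else 0) \<in> borel_measurable lebesgue"
    by (rule borel_measurable_if_I[OF assms(1)]) simp
  then have "f measurable_on I"
    by (subst measurable_on_UNIV[symmetric]) (rule lebesgue_measurable_imp_measurable_on, auto)
  then obtain N g where N: "negligible N" and g: "\<And>n. continuous_on UNIV (g n)"
    and lim: "\<And>x. x \<notin> N \<Longrightarrow> (\<lambda>n. g n x) \<longlonglongrightarrow> (if x \<in> I then f x else 0)"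
    unfolding measurable_on_def by metis
  have cont: "continuous_on S (\<lambda>x. ?T (g n x))" for n S
    by (rule continuous_on_compose2[OF T_cont[of UNIV]]) (auto intro: continuous_on_subset[OF g])
  show ?thesis
  proof (rule approximable_limit)
    show "f \<in> L2 I"
      using assms by (intro L2_bounded[of f C]) auto
    show appr: "approximable (\<lambda>x. ?T (g n x))" for n
      by (rule approximable_continuous[OF cont])
    show "(\<lambda>n. L2_norm I (\<lambda>x. f x - ?T (g n x))) \<longlonglongrightarrow> 0"
    proof (rule L2_norm_dominated_convergence)
      show "f \<in> borel_measurable M" by fact
      show "(\<lambda>x. ?T (g n x)) \<in> borel_measurable M" for n
        using appr[of n] by (intro L2_measurable) (simp add: approximable_def)
      show "integrable M (\<lambda>x. (2 * C)\<^sup>2)" by simp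
      have "cmod (f x - ?T (g n x)) \<le> 2 * C" for n x
        using norm_triangle_ineq4[of "f x" "?T (g n x)"] T[of "g n x"] assms(2)[of x] by linarith
      then show "AE x in M. (cmod (f x - ?T (g n x)))\<^sup>2 \<le> (2 * C)\<^sup>2" for n
        by (intro AE_I2 power_mono) simp_all
      have "AE x in M. x \<notin> N"
        by (rule AE_interval_not_in[OF N])
      moreover have "AE x in M. x \<in> I"
        by (rule AE_interval)
      ultimately show "AE x in M. (\<lambda>n. ?T (g n x)) \<longlonglongrightarrow> f x"
      proof eventually_elim
        case (elim x)
        have "isCont ?T (f x)"
          using T_cont[of UNIV] by (simp add: continuous_on_eq_continuous_at)
        moreover have "(\<lambda>n. g n x) \<longlonglongrightarrow> f x"
          using lim[OF elim(1)] elim(2) by simp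
        ultimately have "(\<lambda>n. ?T (g n x)) \<longlonglongrightarrow> ?T (f x)"
          by (rule isCont_tendsto_compose)
        then show ?case by (simp only: T_f)
      qed
    qed
  qed
qed

lemma C0_infty_dense:
  assumes "f \<in> L2 I" "0 < e"
  obtains \<phi> where "\<phi> \<in> C0_infty I" "L2_norm I (\<lambda>x. f x - \<phi> x) < e"
proof -
  have [measurable]: "f \<in> borel_measurable M"
    by (rule L2_measurable[OF assms(1)])
  have "approximable f"
  proof (rule approximable_limit[OF assms(1)])
    \<comment> \<open>Truncating the large values of \<open>f\<close> leaves an error dominated by \<open>|f|\<close>.\<close>
    let ?g = "\<lambda>n x. if cmod (f x) \<le> real n then f x else 0"
    show "approximable (?g n)" for n
      by (rule approximable_bounded[of _ "real n"]) auto
    show "(\<lambda>n. L2_norm I (\<lambda>x. f x - ?g n x)) \<longlonglongrightarrow> 0"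
    proof (rule L2_norm_dominated_convergence)
      show "integrable M (\<lambda>x. (cmod (f x))\<^sup>2)"
        by (rule L2_integrable_square[OF assms(1)])
      show "AE x in M. (cmod (f x - ?g n x))\<^sup>2 \<le> (cmod (f x))\<^sup>2" for n
        by simp
      have "(\<lambda>n. ?g n x) \<longlonglongrightarrow> f x" for x
      proof (rule tendsto_eventually)
        obtain m where "cmod (f x) \<le> real m" using real_arch_simple by blast
        then show "\<forall>\<^sub>F n in sequentially. ?g n x = f x"
          unfolding eventually_sequentially by (intro exI[of _ m]) auto
      qed
      then show "AE x in M. (\<lambda>n. ?g n x) \<longlonglongrightarrow> f x" by simp
    qed measurable
  qed
  then show thesis
    using assms(2) that unfolding approximable_def by blast
qed

lemma integral_eq_HK:
  assumes "f \<in> C0_infty I"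
  shows "(LINT x|M. f x) = integral {a..b} f"
  using lebesgue_integral_eq_integral[OF L2_integrable[OF L2_C0_infty[OF assms]]]
  by (simp add: integral_open_interval_real)

text \<open>
  A test function is the derivative of a test function exactly if its integral vanishes. So \<open>v\<close> is
  first approximated by an arbitrary test function \<open>\<psi>\<close>, and the integral of \<open>\<psi>\<close>, which is small
  because that of \<open>v\<close> is zero, is removed by subtracting a multiple of a fixed test function \<open>\<eta>\<close>
  with nonzero integral.
\<close>

lemma derivatives_dense_in_mean_zero:
  assumes "v \<in> L2 I" "(LINT x|M. v x) = 0" "0 < e"
  obtains \<phi> \<phi>' where "\<phi> \<in> C0_infty I" "\<phi>' \<in> C0_infty I"
    "\<And>x. (\<phi> has_vector_derivative \<phi>' x) (at x)" "L2_norm I (\<lambda>x. v x - \<phi>' x) < e"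
proof -
  let ?s = "sqrt (b - a)"
  have s: "0 < ?s" "?s * ?s = b - a" using a_less_b by simp_all
  \<comment> \<open>A test function close enough to the constant one has a nonzero integral.\<close>
  obtain \<eta> where \<eta>: "\<eta> \<in> C0_infty I" "L2_norm I (\<lambda>x. 1 - \<eta> x) < ?s"
    using C0_infty_dense[OF L2_const[of 1] s(1)] by blast
  define k where "k = (LINT x|M. \<eta> x)"
  have "cmod (of_real (b - a) - k) = cmod (LINT x|M. 1 - \<eta> x)"
    using L2_integrable[OF L2_C0_infty[OF \<eta>(1)]] measure_interval
    by (simp add: k_def scaleR_conv_of_real)
  also have "\<dots> \<le> ?s * L2_norm I (\<lambda>x. 1 - \<eta> x)"
    by (intro norm_integral_le_L2_norm L2_diff L2_const L2_C0_infty \<eta>(1))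
  also have "\<dots> < b - a"
    using mult_strict_left_mono[OF \<eta>(2) s(1)] s(2) by simp
  finally have "k \<noteq> 0" using a_less_b by (auto simp del: of_real_diff)
  define K where "K = L2_norm I \<eta> / cmod k"
  have "K \<ge> 0" by (simp add: K_def L2_norm_nonneg)
  then have pos: "0 < 1 + ?s * K" using s by (simp add: add_pos_nonneg)
  obtain \<psi> where \<psi>: "\<psi> \<in> C0_infty I" "L2_norm I (\<lambda>x. v x - \<psi> x) < e / (1 + ?s * K)"
    using C0_infty_dense[OF assms(1), of "e / (1 + ?s * K)"] assms(3) pos by auto
  define m where "m = (LINT x|M. \<psi> x)"
  define \<zeta> where "\<zeta> = (\<lambda>x. \<psi> x + (- m / k) * \<eta> x)"
  have \<zeta>: "\<zeta> \<in> C0_infty I"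
    unfolding \<zeta>_def
    by (intro C0_infty_add C0_infty_mult_smooth smooth_const a_less_b \<psi>(1) \<eta>(1))
  have L2: "\<psi> \<in> L2 I" "\<eta> \<in> L2 I" "\<zeta> \<in> L2 I"
    by (intro L2_C0_infty \<psi> \<eta> \<zeta>)+
  have "(LINT x|M. \<zeta> x) = m + (- m / k) * k"
    unfolding \<zeta>_def m_def k_def using L2_integrable[OF L2(1)] L2_integrable[OF L2(2)] by simp
  then have "integral {a..b} \<zeta> = 0"
    using \<open>k \<noteq> 0\<close> integral_eq_HK[OF \<zeta>] by simp
  then obtain \<phi> where \<phi>: "\<phi> \<in> C0_infty I" "\<And>x. (\<phi> has_vector_derivative \<zeta> x) (at x)"
    using C0_infty_antideriv[OF a_less_b \<zeta>] by blast
  have "cmod m = cmod (LINT x|M. v x - \<psi> x)"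
    using assms(2) L2_integrable[OF L2(1)] L2_integrable[OF assms(1)] by (simp add: m_def)
  also have "\<dots> \<le> ?s * L2_norm I (\<lambda>x. v x - \<psi> x)"
    by (intro norm_integral_le_L2_norm L2_diff assms(1) L2)
  finally have m: "cmod m \<le> ?s * L2_norm I (\<lambda>x. v x - \<psi> x)" .
  have "L2_norm I (\<lambda>x. v x - \<zeta> x) \<le> L2_norm I (\<lambda>x. v x - \<psi> x) + L2_norm I (\<lambda>x. m / k * \<eta> x)"
    using L2_norm_triangle[OF L2_diff[OF assms(1) L2(1)] L2_cmult[OF L2(2), of "m / k"]]
    by (simp add: \<zeta>_def algebra_simps)
  also have "L2_norm I (\<lambda>x. m / k * \<eta> x) = cmod m * K"
    by (simp only: L2_norm_cmult K_def norm_divide) simp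
  also have "L2_norm I (\<lambda>x. v x - \<psi> x) + cmod m * K \<le>
      L2_norm I (\<lambda>x. v x - \<psi> x) + ?s * L2_norm I (\<lambda>x. v x - \<psi> x) * K"
    using mult_right_mono[OF m \<open>K \<ge> 0\<close>] by simp
  also have "\<dots> = L2_norm I (\<lambda>x. v x - \<psi> x) * (1 + ?s * K)"
    by (simp add: algebra_simps)
  also have "\<dots> < e"
    using \<psi>(2) pos by (simp add: pos_less_divide_eq)
  finally show thesis using that \<phi> \<zeta> by blast
qed

section \<open>Primitives of integrable functions\<close>

text \<open>
  The integral of \<open>f\<close> from \<open>a\<close> to \<open>x\<close>. The variable end point sits in the integrand rather than in the
  domain, so that the theorems on product measures apply to one fixed finite measure.
\<close>

definition primitive :: "(real \<Rightarrow> complex) \<Rightarrow> real \<Rightarrow> complex" where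
  "primitive f x = (LINT t|M. (if t < x then f t else 0))"

lemma measurable_ident_interval [measurable]: "(\<lambda>x. x) \<in> borel_measurable M"
  by (rule continuous_imp_measurable_on_sets_lebesgue) (auto intro: continuous_on_id)

lemma integrable_truncated:
  assumes "integrable M f"
  shows "integrable M (\<lambda>t. if t < x then f t else (0::complex))"
proof (rule Bochner_Integration.integrable_bound[OF assms])
  show "(\<lambda>t. if t < x then f t else 0) \<in> borel_measurable M"
    using borel_measurable_integrable[OF assms] by measurable
qed simp

lemma primitive_bound:
  assumes "integrable M f"
  shows "cmod (primitive f x) \<le> (LINT t|M. cmod (f t))"
proof -
  have "cmod (primitive f x) \<le> (LINT t|M. cmod (if t < x then f t else 0))"
    unfolding primitive_def by (rule integral_norm_bound)
  also have "\<dots> \<le> (LINT t|M. cmod (f t))"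
    by (rule integral_mono) (use integrable_truncated[OF assms] assms in simp_all)
  finally show ?thesis .
qed

lemma primitive_add: "integrable M f \<Longrightarrow> integrable M g \<Longrightarrow> primitive (\<lambda>x. f x + g x) x = primitive f x + primitive g x"
  unfolding primitive_def
  by (subst Bochner_Integration.integral_add[symmetric])
    (auto intro!: integrable_truncated Bochner_Integration.integral_cong)

lemma primitive_cmult: "primitive (\<lambda>x. c * f x) x = c * primitive f x"
proof -
  have "primitive (\<lambda>x. c * f x) x = (LINT t|M. c * (if t < x then f t else 0))"
    unfolding primitive_def by (intro Bochner_Integration.integral_cong) auto
  also have "\<dots> = c * primitive f x"
    unfolding primitive_def by (rule integral_mult_right_zero)
  finally show ?thesis .
qed

lemma primitive_uminus: "primitive (\<lambda>x. - f x) x = - primitive f x"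
  using primitive_cmult[of "-1" f x] by simp

lemma primitive_diff: "integrable M f \<Longrightarrow> integrable M g \<Longrightarrow> primitive (\<lambda>x. f x - g x) x = primitive f x - primitive g x"
  using primitive_add[of f "\<lambda>x. - g x" x] by (simp add: primitive_uminus)

lemma primitive_cnj: "primitive (\<lambda>x. cnj (f x)) x = cnj (primitive f x)"
proof -
  have "primitive (\<lambda>x. cnj (f x)) x = (LINT t|M. cnj (if t < x then f t else 0))"
    unfolding primitive_def by (intro Bochner_Integration.integral_cong) auto
  also have "\<dots> = cnj (primitive f x)"
    unfolding primitive_def by (rule Bochner_Integration.integral_cnj)
  finally show ?thesis .
qed

lemma primitive_cong_AE:
  assumes "AE x in M. f x = g x" "integrable M f" "integrable M g"
  shows "primitive f x = primitive g x"
  unfolding primitive_def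
proof (rule integral_cong_AE)
  show "AE t in M. (if t < x then f t else 0) = (if t < x then g t else 0)"
    using assms(1) by eventually_elim simp
qed (use integrable_truncated[OF assms(2)] integrable_truncated[OF assms(3)] in simp_all)

lemma primitive_measurable:
  assumes "integrable M f"
  shows "primitive f \<in> borel_measurable M"
proof -
  have [measurable]: "f \<in> borel_measurable M"
    using assms by (rule borel_measurable_integrable)
  have "(\<lambda>(x, t). if t < x then f t else 0) \<in> borel_measurable (M \<Otimes>\<^sub>M M)"
    by measurable
  from M.borel_measurable_lebesgue_integral[OF this] show ?thesis
    by (simp add: primitive_def[abs_def])
qed

lemma primitive_L2: "integrable M f \<Longrightarrow> primitive f \<in> L2 I"
  by (rule L2_bounded[OF primitive_measurable, of _ "LINT t|M. cmod (f t)"]) (simp_all add: primitive_bound)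

text \<open>
  Fubini on the triangle \<open>t < x\<close>; for \<open>f\<close> and \<open>g\<close> that are merely integrable this replaces the
  product rule.
\<close>

lemma integral_by_parts:
  assumes f: "integrable M f" and g: "integrable M g"
  shows "(LINT x|M. g x * primitive f x) = (LINT x|M. f x) * (LINT x|M. g x) - (LINT x|M. f x * primitive g x)"
proof -
  interpret P: pair_sigma_finite M M ..
  have [measurable]: "f \<in> borel_measurable M" "g \<in> borel_measurable M"
    using f g by (auto intro: borel_measurable_integrable)
  have "integrable (M \<Otimes>\<^sub>M M) (\<lambda>(x, t). g x * f t)"
    by (rule P.Fubini_integrable) (use f g in \<open>auto simp: norm_mult\<close>)
  then have K: "integrable (M \<Otimes>\<^sub>M M) (\<lambda>(x, t). if t < x then g x * f t else 0)"
    by (rule Bochner_Integration.integrable_bound) auto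
  have split: "(LINT x|M. (if t < x then g x else 0)) = (LINT x|M. g x) - primitive g t" for t
  proof -
    have "AE x in M. x \<notin> {t}"
      by (rule AE_interval_not_in) simp
    then have "AE x in M. (if t < x then g x else 0) = g x - (if x < t then g x else 0)"
      by eventually_elim auto
    then have "(LINT x|M. (if t < x then g x else 0)) = (LINT x|M. g x - (if x < t then g x else 0))"
      by (intro integral_cong_AE) measurable
    also have "\<dots> = (LINT x|M. g x) - primitive g t"
      unfolding primitive_def by (intro Bochner_Integration.integral_diff g integrable_truncated)
    finally show ?thesis .
  qed
  have "(LINT t|M. (if t < x then g x * f t else 0)) = g x * primitive f x" for x
    using primitive_cmult[of "g x" f x] unfolding primitive_def .
  then have "(LINT x|M. g x * primitive f x) = (LINT x|M. LINT t|M. (if t < x then g x * f t else 0))"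
    by (simp only:)
  also have "\<dots> = (LINT t|M. LINT x|M. (if t < x then g x * f t else 0))"
    by (rule P.Fubini_integral[OF K, symmetric])
  also have "\<dots> = (LINT t|M. f t * (LINT x|M. (if t < x then g x else 0)))"
  proof (rule Bochner_Integration.integral_cong[OF refl])
    fix t
    have "(LINT x|M. (if t < x then g x * f t else 0)) = (LINT x|M. f t * (if t < x then g x else 0))"
      by (intro Bochner_Integration.integral_cong) auto
    then show "(LINT x|M. (if t < x then g x * f t else 0)) = f t * (LINT x|M. (if t < x then g x else 0))"
      by (simp only: integral_mult_right_zero)
  qed
  also have "\<dots> = (LINT t|M. f t * (LINT x|M. g x) - f t * primitive g t)"
    by (simp only: split right_diff_distrib)
  also have "\<dots> = (LINT x|M. f x) * (LINT x|M. g x) - (LINT x|M. f x * primitive g x)"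
  proof (subst Bochner_Integration.integral_diff)
    show "integrable M (\<lambda>t. f t * primitive g t)"
    proof (rule Bochner_Integration.integrable_bound)
      show "integrable M (\<lambda>t. (LINT s|M. cmod (g s)) * f t)"
        using f by simp
      show "(\<lambda>t. f t * primitive g t) \<in> borel_measurable M"
        using primitive_measurable[OF g] by measurable
      have "norm (f t * primitive g t) \<le> norm ((LINT s|M. cmod (g s)) * f t)" for t
        using mult_left_mono[OF primitive_bound[OF g, of t], of "cmod (f t)"]
        by (simp add: norm_mult mult.commute)
      then show "AE t in M. norm (f t * primitive g t) \<le> norm ((LINT s|M. cmod (g s)) * f t)"
        by simp
    qed
  qed (use f in auto)
  finally show ?thesis .
qed

lemma C0_infty_derivative_integral:
  assumes "\<phi> \<in> C0_infty I" "\<phi>' \<in> C0_infty I" "\<And>x. (\<phi> has_vector_derivative \<phi>' x) (at x)"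
  shows "(LINT x|M. \<phi>' x) = 0" and "x \<in> I \<Longrightarrow> primitive \<phi>' x = \<phi> x"
proof -
  obtain c d where "a < c" "d < b" "\<And>x. x \<notin> {c..d} \<Longrightarrow> \<phi> x = 0"
    using assms(1) unfolding C0_infty_iff[OF a_less_b] by blast
  then have ab: "\<phi> a = 0" "\<phi> b = 0" by simp_all
  have FTC: "(\<phi>' has_integral \<phi> y - \<phi> a) {a..y}" if "a \<le> y" for y
    by (rule fundamental_theorem_of_calculus[OF that has_vector_derivative_at_within[OF assms(3)]])
  show "(LINT x|M. \<phi>' x) = 0"
    using integral_unique[OF FTC[OF less_imp_le[OF a_less_b]]] ab
    by (simp only: integral_eq_HK[OF assms(2)] diff_self)
  assume x: "x \<in> I"
  have "((\<lambda>t. if t \<in> {a..x} then \<phi>' t else 0) has_integral \<phi> x) {a..b}"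
    using FTC[of x] x ab by (subst has_integral_restrict) simp_all
  then have "((\<lambda>t. if t < x then \<phi>' t else 0) has_integral \<phi> x) {a..b}"
    by (rule has_integral_spike_finite[of "{x}", rotated 2]) (use x in auto)
  then have "integral I (\<lambda>t. if t < x then \<phi>' t else 0) = \<phi> x"
    by (subst integral_open_interval_real[symmetric]) (rule integral_unique)
  moreover have "integrable M (\<lambda>t. if t < x then \<phi>' t else 0)"
    by (intro integrable_truncated L2_integrable L2_C0_infty assms(2))
  ultimately show "primitive \<phi>' x = \<phi> x"
    unfolding primitive_def by (subst lebesgue_integral_eq_integral) simp_all
qed

section \<open>The weak derivative\<close>

text \<open>
  The graph of the adjoint tests against all representatives of test functions; it suffices to test
  against the test functions themselves and their pointwise derivatives.
\<close>

lemma D_adjoint_iff_weak: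
  "(q, r) \<in> L2_adjoint I (D_op I) \<longleftrightarrow> q \<in> L2 I \<and> r \<in> L2 I \<and>
    (\<forall>\<phi>\<in>C0_infty I. \<forall>\<phi>'\<in>C0_infty I. (\<forall>x. (\<phi> has_vector_derivative \<phi>' x) (at x)) \<longrightarrow>
      L2_inner I \<phi>' q = L2_inner I \<phi> r)"
  (is "?lhs \<longleftrightarrow> ?rhs")
proof
  assume lhs: ?lhs
  have "L2_inner I \<phi>' q = L2_inner I \<phi> r"
    if "\<phi> \<in> C0_infty I" "\<phi>' \<in> C0_infty I" "\<forall>x. (\<phi> has_vector_derivative \<phi>' x) (at x)" for \<phi> \<phi>'
  proof -
    have "\<phi>' x = vector_derivative \<phi> (at x)" for x
      using that(3) by (metis vector_derivative_at)
    then have "(\<phi>, \<phi>') \<in> D_op I"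
      using that(1,2) unfolding D_op_def by (auto intro!: L2_C0_infty bexI[of _ \<phi>])
    then show ?thesis
      using lhs unfolding L2_adjoint_def by fast
  qed
  then show ?rhs
    using lhs unfolding L2_adjoint_def by blast
next
  assume rhs: ?rhs
  have "L2_inner I g q = L2_inner I f r" if fg: "(f, g) \<in> D_op I" for f g
  proof -
    obtain \<phi> where L2: "f \<in> L2 I" "g \<in> L2 I" and \<phi>: "\<phi> \<in> C0_infty I" "AE x in M. f x = \<phi> x"
      "AE x in M. g x = vector_derivative \<phi> (at x)"
      using fg by (auto simp: D_op_def)
    obtain \<phi>' where \<phi>': "\<phi>' \<in> C0_infty I" "\<And>x. (\<phi> has_vector_derivative \<phi>' x) (at x)"
      by (rule C0_infty_derivE[OF a_less_b \<phi>(1)]) blast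
    then have "AE x in M. g x = \<phi>' x"
      using \<phi>(3) by (simp add: vector_derivative_at[OF \<phi>'(2)])
    then have "L2_inner I g q = L2_inner I \<phi>' q"
      using rhs L2 L2_C0_infty[OF \<phi>'(1)] by (intro L2_inner_cong) auto
    also have "\<dots> = L2_inner I \<phi> r"
      using rhs \<phi>(1) \<phi>' by blast
    also have "\<dots> = L2_inner I f r"
      using rhs L2 L2_C0_infty[OF \<phi>(1)] \<phi>(2)
      by (intro L2_inner_cong) (simp_all add: eq_commute)
    finally show ?thesis .
  qed
  then show ?lhs
    using rhs unfolding L2_adjoint_def by blast
qed

lemma D_adjoint_L2:
  "(q, r) \<in> L2_adjoint I (D_op I) \<Longrightarrow> q \<in> L2 I"
  "(q, r) \<in> L2_adjoint I (D_op I) \<Longrightarrow> r \<in> L2 I"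
  by (simp_all add: L2_adjoint_def)

lemma D_adjoint_diff:
  assumes "(q, r) \<in> L2_adjoint I (D_op I)" "(q', r') \<in> L2_adjoint I (D_op I)"
  shows "(\<lambda>x. q x - q' x, \<lambda>x. r x - r' x) \<in> L2_adjoint I (D_op I)"
  using assms unfolding D_adjoint_iff_weak
  by (simp add: L2_diff L2_inner_diff_right L2_C0_infty)

text \<open>
  Integration by parts; the boundary terms vanish because derivatives of test functions have integral
  zero, which also disposes of the constant.
\<close>

lemma D_adjoint_primitive:
  assumes q: "q \<in> L2 I" and r: "r \<in> L2 I" and qr: "AE x in M. q x = c - primitive r x"
  shows "(q, r) \<in> L2_adjoint I (D_op I)"
  unfolding D_adjoint_iff_weak
proof (intro conjI ballI impI q r)
  fix \<phi> \<phi>' assume \<phi>: "\<phi> \<in> C0_infty I" "\<phi>' \<in> C0_infty I" "\<forall>x. (\<phi> has_vector_derivative \<phi>' x) (at x)"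
  have L2: "\<phi> \<in> L2 I" "\<phi>' \<in> L2 I" using \<phi> by (auto intro: L2_C0_infty)
  note int = L2_integrable[OF L2(2)] L2_integrable[OF L2_cnj[OF r]]
  have primitive: "primitive (\<lambda>x. cnj (r x)) \<in> L2 I" by (rule primitive_L2[OF int(2)])
  have "L2_inner I \<phi>' q = L2_inner I \<phi>' (\<lambda>x. c - primitive r x)"
    using qr L2 q L2_diff[OF L2_const primitive_L2[OF L2_integrable[OF r]], of c] by (intro L2_inner_cong) auto
  also have "\<dots> = (LINT x|M. \<phi>' x * cnj c - \<phi>' x * primitive (\<lambda>x. cnj (r x)) x)"
    by (simp add: L2_inner_def primitive_cnj right_diff_distrib)
  also have "\<dots> = (LINT x|M. \<phi>' x) * cnj c - (LINT x|M. \<phi>' x * primitive (\<lambda>x. cnj (r x)) x)"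
    using int(1) L2_integrable_mult[OF L2(2) primitive] by simp
  also have "\<dots> = (LINT x|M. cnj (r x) * primitive \<phi>' x)"
    using C0_infty_derivative_integral(1)[OF \<phi>(1,2) spec[OF \<phi>(3)]] integral_by_parts[OF int(2,1)]
    by simp
  also have "\<dots> = L2_inner I \<phi> r"
    unfolding L2_inner_def
  proof (rule Bochner_Integration.integral_cong[OF refl])
    fix x assume "x \<in> space M"
    then have "primitive \<phi>' x = \<phi> x"
      using \<phi>(3) by (intro C0_infty_derivative_integral(2)[OF \<phi>(1,2)]) simp_all
    then show "cnj (r x) * primitive \<phi>' x = \<phi> x * cnj (r x)" by simp
  qed
  finally show "L2_inner I \<phi>' q = L2_inner I \<phi> r" .
qed

lemma L2_inner_const_right: "L2_inner I f (\<lambda>x. c) = (LINT x|M. f x) * cnj c"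
  by (simp add: L2_inner_def)

text \<open>
  Du Bois-Reymond's lemma: \<open>w = q + \<integral> r\<close> has weak derivative zero, hence \<open>w\<close> minus its mean \<open>m\<close> is
  orthogonal to the derivatives of test functions. As these are dense among the functions of mean
  zero, and \<open>w - m\<close> is such a function, \<open>w = m\<close>.
\<close>

lemma D_adjoint_imp_primitive:
  assumes qr: "(q, r) \<in> L2_adjoint I (D_op I)"
  obtains c where "AE x in M. q x = c - primitive r x"
proof -
  have q: "q \<in> L2 I" and r: "r \<in> L2 I" using qr by (auto simp: L2_adjoint_def)
  have Jr: "primitive r \<in> L2 I" by (intro primitive_L2 L2_integrable r)
  define w where "w = (\<lambda>x. q x + primitive r x)"
  have w: "w \<in> L2 I" unfolding w_def by (intro L2_add q Jr)
  define m where "m = (LINT x|M. w x) / of_real (b - a)"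
  have wm: "(\<lambda>x. w x - m) \<in> L2 I" by (intro L2_diff L2_const w)
  have mean: "(LINT x|M. w x - m) = 0"
    using a_less_b measure_interval L2_integrable[OF w] by (simp add: m_def scaleR_conv_of_real)
  have "(\<lambda>x. - primitive r x, r) \<in> L2_adjoint I (D_op I)"
    by (rule D_adjoint_primitive[of _ _ 0]) (auto intro: L2_uminus Jr r)
  from D_adjoint_diff[OF qr this] have w0: "(w, \<lambda>x. 0) \<in> L2_adjoint I (D_op I)"
    by (simp add: w_def)
  have "AE x in M. w x - m = 0"
  proof (rule AE_zero_if_orthogonal_to_approximants[OF wm])
    fix e :: real assume "e > 0"
    then obtain \<phi> \<phi>' where \<phi>: "\<phi> \<in> C0_infty I" "\<phi>' \<in> C0_infty I"
        "\<And>x. (\<phi> has_vector_derivative \<phi>' x) (at x)" "L2_norm I (\<lambda>x. w x - m - \<phi>' x) < e"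
      using derivatives_dense_in_mean_zero[OF wm mean] by blast
    have "L2_inner I \<phi>' w = 0"
      using w0 \<phi> unfolding D_adjoint_iff_weak by (simp add: L2_inner_def)
    then have "L2_inner I \<phi>' (\<lambda>x. w x - m) = 0"
      using C0_infty_derivative_integral(1)[OF \<phi>(1-3)] L2_C0_infty[OF \<phi>(2)] w
      by (simp add: L2_inner_diff_right L2_const L2_inner_const_right)
    then show "\<exists>d\<in>L2 I. L2_norm I (\<lambda>x. w x - m - d x) < e \<and> L2_inner I d (\<lambda>x. w x - m) = 0"
      using \<phi>(4) L2_C0_infty[OF \<phi>(2)] by blast
  qed
  then have "AE x in M. q x = m - primitive r x"
    by eventually_elim (simp add: w_def algebra_simps)
  then show thesis by (rule that)
qed

text \<open>
  Because the test functions are dense: \<open>r - r'\<close> is orthogonal to all of them.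
\<close>

lemma D_adjoint_unique:
  assumes "(q, r) \<in> L2_adjoint I (D_op I)" "(q', r') \<in> L2_adjoint I (D_op I)"
    and "AE x in M. q x = q' x"
  shows "AE x in M. r x = r' x"
proof -
  have L2: "q \<in> L2 I" "r \<in> L2 I" "q' \<in> L2 I" "r' \<in> L2 I"
    using assms by (auto simp: L2_adjoint_def)
  have "AE x in M. r x - r' x = 0"
  proof (rule AE_zero_if_orthogonal_to_approximants[OF L2_diff[OF L2(2,4)]])
    fix e :: real assume "e > 0"
    then obtain \<phi> where \<phi>: "\<phi> \<in> C0_infty I" "L2_norm I (\<lambda>x. r x - r' x - \<phi> x) < e"
      using C0_infty_dense[OF L2_diff[OF L2(2,4)]] by blast
    obtain \<phi>' where \<phi>': "\<phi>' \<in> C0_infty I" "\<And>x. (\<phi> has_vector_derivative \<phi>' x) (at x)"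
      by (rule C0_infty_derivE[OF a_less_b \<phi>(1)]) blast
    have "L2_inner I \<phi> (\<lambda>x. r x - r' x) = L2_inner I \<phi>' (\<lambda>x. q x - q' x)"
      using D_adjoint_diff[OF assms(1,2)] \<phi>(1) \<phi>' unfolding D_adjoint_iff_weak by simp
    also have "\<dots> = L2_inner I \<phi>' (\<lambda>x. 0)"
      using assms(3) L2_C0_infty[OF \<phi>'(1)] L2_diff[OF L2(1,3)]
      by (intro L2_inner_cong) (simp_all add: L2_const)
    finally have "L2_inner I \<phi> (\<lambda>x. r x - r' x) = 0" by (simp add: L2_inner_def)
    then show "\<exists>d\<in>L2 I. L2_norm I (\<lambda>x. r x - r' x - d x) < e \<and> L2_inner I d (\<lambda>x. r x - r' x) = 0"
      using \<phi> L2_C0_infty by blast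
  qed
  then show ?thesis by simp
qed

lemma D_adj_in_adjoint: "q \<in> W1 I \<Longrightarrow> (q, D_adj I q) \<in> L2_adjoint I (D_op I)"
  unfolding W1_def D_adj_def op_apply_def by (metis Domain.cases someI)

text \<open>
  The value of the adjoint is an arbitrarily chosen representative, so it is known up to null sets
  only; this lemma is how concrete weak derivatives are identified with it.
\<close>

lemma D_adj_eq_AE:
  assumes "(q, r) \<in> L2_adjoint I (D_op I)"
  shows "q \<in> W1 I" "AE x in M. D_adj I q x = r x"
proof -
  show "q \<in> W1 I" using assms by (auto simp: W1_def)
  then show "AE x in M. D_adj I q x = r x"
    by (intro D_adjoint_unique[OF D_adj_in_adjoint assms]) simp_all
qed

section \<open>The Sobolev space with zero boundary values\<close>

lemma L2_norm_le_W1_norm: "L2_norm I f \<le> W1_norm I f" "L2_norm I (D_adj I f) \<le> W1_norm I f"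
  by (simp_all add: W1_norm_def real_le_rsqrt)

lemma W1_norm_le: "W1_norm I f \<le> L2_norm I f + L2_norm I (D_adj I f)"
  unfolding W1_norm_def by (intro real_le_lsqrt) (simp_all add: L2_norm_nonneg power2_sum)

lemma C0_infty_D_adjoint:
  assumes "\<phi> \<in> C0_infty I" "\<phi>' \<in> C0_infty I" "\<And>x. (\<phi> has_vector_derivative \<phi>' x) (at x)"
  shows "(\<phi>, \<lambda>x. - \<phi>' x) \<in> L2_adjoint I (D_op I)"
proof (rule D_adjoint_primitive[of _ _ 0])
  show "\<phi> \<in> L2 I" "(\<lambda>x. - \<phi>' x) \<in> L2 I"
    using assms by (auto intro: L2_C0_infty L2_uminus)
  show "AE x in M. \<phi> x = 0 - primitive (\<lambda>x. - \<phi>' x) x"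
    by (rule AE_interval) (simp add: primitive_uminus C0_infty_derivative_integral(2)[OF assms])
qed

text \<open>
  Functions vanishing at both end points (the integral of \<open>v\<close> is the value at \<open>b\<close>) belong to
  the closure of the test functions: approximating \<open>v\<close> by \<open>\<phi>'\<close> in \<open>L\<^sup>2\<close> controls \<open>u - \<phi>\<close> uniformly,
  since both are primitives starting at \<open>a\<close>.
\<close>

lemma W10_I:
  assumes u: "u \<in> L2 I" and v: "v \<in> L2 I" and mean: "(LINT x|M. v x) = 0"
    and uv: "AE x in M. u x = primitive v x"
  shows "u \<in> W10 I" "AE x in M. D_adj I u x = - v x"
proof -
  have adj: "(u, \<lambda>x. - v x) \<in> L2_adjoint I (D_op I)"
    using uv by (intro D_adjoint_primitive[of _ _ 0] L2_uminus u v) (simp add: primitive_uminus)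
  show "AE x in M. D_adj I u x = - v x" by (rule D_adj_eq_AE(2)[OF adj])
  have "\<exists>\<phi>\<in>C0_infty I. W1_norm I (\<lambda>x. u x - \<phi> x) < e" if "e > 0" for e
  proof -
    have pos: "0 < b - a + 1" using a_less_b by simp
    then have "e / (b - a + 1) > 0" using that by simp
    then obtain \<phi> \<phi>' where \<phi>: "\<phi> \<in> C0_infty I" "\<phi>' \<in> C0_infty I"
        "\<And>x. (\<phi> has_vector_derivative \<phi>' x) (at x)" "L2_norm I (\<lambda>x. v x - \<phi>' x) < e / (b - a + 1)"
      using derivatives_dense_in_mean_zero[OF v mean] by blast
    have L2: "\<phi> \<in> L2 I" "\<phi>' \<in> L2 I" using \<phi> by (auto intro: L2_C0_infty)
    define \<delta> where "\<delta> = L2_norm I (\<lambda>x. v x - \<phi>' x)"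
    have "\<delta> \<ge> 0" by (simp add: \<delta>_def L2_norm_nonneg)
    have "(\<lambda>x. u x - \<phi> x, \<lambda>x. - v x - - \<phi>' x) \<in> L2_adjoint I (D_op I)"
      by (rule D_adjoint_diff[OF adj C0_infty_D_adjoint[OF \<phi>(1-3)]])
    note D = D_adj_eq_AE[OF this]
    have "L2_norm I (D_adj I (\<lambda>x. u x - \<phi> x)) = \<delta>"
      unfolding \<delta>_def
    proof (rule L2_norm_cong)
      show "AE x in M. cmod (D_adj I (\<lambda>x. u x - \<phi> x) x) = cmod (v x - \<phi>' x)"
        using D(2) by eventually_elim (simp add: norm_minus_commute)
      show "D_adj I (\<lambda>x. u x - \<phi> x) \<in> borel_measurable M"
        by (rule L2_measurable[OF D_adjoint_L2(2)[OF D_adj_in_adjoint[OF D(1)]]])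
      show "(\<lambda>x. v x - \<phi>' x) \<in> borel_measurable M"
        by (intro L2_measurable L2_diff v L2)
    qed
    moreover have "L2_norm I (\<lambda>x. u x - \<phi> x) \<le> sqrt (b - a) * \<delta> * sqrt (b - a)"
    proof (rule L2_norm_le_bound)
      show "(\<lambda>x. u x - \<phi> x) \<in> L2 I" by (intro L2_diff u L2)
      have "AE x in M. \<phi> x = primitive \<phi>' x"
        by (rule AE_interval) (simp add: C0_infty_derivative_integral(2)[OF \<phi>(1-3)])
      with uv show "AE x in M. cmod (u x - \<phi> x) \<le> sqrt (b - a) * \<delta>"
      proof eventually_elim
        case (elim x)
        then have "u x - \<phi> x = primitive (\<lambda>x. v x - \<phi>' x) x"
          using v L2 by (simp add: primitive_diff L2_integrable)
        then have "cmod (u x - \<phi> x) \<le> (LINT x|M. cmod (v x - \<phi>' x))"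
          using primitive_bound[OF L2_integrable[OF L2_diff[OF v L2(2)]]] by simp
        also have "\<dots> \<le> sqrt (b - a) * \<delta>"
          unfolding \<delta>_def by (rule L1_le_L2_norm[OF L2_diff[OF v L2(2)]])
        finally show ?case .
      qed
    qed (use \<open>\<delta> \<ge> 0\<close> a_less_b in simp)
    moreover have "sqrt (b - a) * \<delta> * sqrt (b - a) = (b - a) * \<delta>"
      using a_less_b by simp
    ultimately have "W1_norm I (\<lambda>x. u x - \<phi> x) \<le> (b - a + 1) * \<delta>"
      using W1_norm_le[of "\<lambda>x. u x - \<phi> x"] by (simp add: algebra_simps)
    also have "\<dots> < e"
      using \<phi>(4) pos by (simp add: \<delta>_def pos_less_divide_eq mult.commute)
    finally show ?thesis using \<phi>(1) by blast
  qed
  then show "u \<in> W10 I"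
    using D_adj_eq_AE(1)[OF adj] by (simp add: W10_def)
qed

text \<open>
  Green's formula without boundary terms. It holds for test functions by definition of the adjoint,
  and both sides are continuous with respect to the \<open>W\<^sup>1\<close>-norm.
\<close>

lemma W10_Green:
  assumes u: "u \<in> W10 I" and qr: "(q, r) \<in> L2_adjoint I (D_op I)"
  shows "L2_inner I (\<lambda>x. - D_adj I u x) q = L2_inner I u r"
proof -
  have "u \<in> W1 I" using u by (simp add: W10_def)
  note adj = D_adj_in_adjoint[OF this]
  note L2 = D_adjoint_L2[OF adj] D_adjoint_L2[OF qr]
  define d where "d = (\<lambda>x. - D_adj I u x)"
  have d: "d \<in> L2 I" unfolding d_def by (intro L2_uminus L2)
  define K where "K = L2_norm I q + L2_norm I r"
  have "K \<ge> 0" by (simp add: K_def L2_norm_nonneg)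
  have "cmod (L2_inner I d q - L2_inner I u r) \<le> e * K" if e: "e > 0" for e
  proof -
    obtain \<phi> where \<phi>: "\<phi> \<in> C0_infty I" "W1_norm I (\<lambda>x. u x - \<phi> x) < e"
      using u e unfolding W10_def by blast
    obtain \<phi>' where \<phi>': "\<phi>' \<in> C0_infty I" "\<And>x. (\<phi> has_vector_derivative \<phi>' x) (at x)"
      by (rule C0_infty_derivE[OF a_less_b \<phi>(1)]) blast
    have L2': "\<phi> \<in> L2 I" "\<phi>' \<in> L2 I" using \<phi> \<phi>' by (auto intro: L2_C0_infty)
    have "(\<lambda>x. u x - \<phi> x, \<lambda>x. D_adj I u x - - \<phi>' x) \<in> L2_adjoint I (D_op I)"
      by (rule D_adjoint_diff[OF adj C0_infty_D_adjoint[OF \<phi>(1) \<phi>']])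
    note D = D_adj_eq_AE[OF this]
    have "L2_norm I (\<lambda>x. d x - \<phi>' x) = L2_norm I (D_adj I (\<lambda>x. u x - \<phi> x))"
    proof (rule L2_norm_cong)
      show "AE x in M. cmod (d x - \<phi>' x) = cmod (D_adj I (\<lambda>x. u x - \<phi> x) x)"
        using D(2)
      proof eventually_elim
        case (elim x)
        have "d x - \<phi>' x = - (D_adj I u x - - \<phi>' x)" by (simp add: d_def)
        then show ?case using elim by (simp only: norm_minus_cancel)
      qed
      show "D_adj I (\<lambda>x. u x - \<phi> x) \<in> borel_measurable M"
        by (rule L2_measurable[OF D_adjoint_L2(2)[OF D_adj_in_adjoint[OF D(1)]]])
      show "(\<lambda>x. d x - \<phi>' x) \<in> borel_measurable M"
        by (intro L2_measurable L2_diff d L2')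
    qed
    then have small: "L2_norm I (\<lambda>x. d x - \<phi>' x) \<le> e" "L2_norm I (\<lambda>x. u x - \<phi> x) \<le> e"
      using \<phi>(2) L2_norm_le_W1_norm[of "\<lambda>x. u x - \<phi> x"] by linarith+
    have "L2_inner I \<phi>' q = L2_inner I \<phi> r"
      using qr \<phi>(1) \<phi>' unfolding D_adjoint_iff_weak by blast
    then have "L2_inner I d q - L2_inner I u r =
        L2_inner I (\<lambda>x. d x - \<phi>' x) q - L2_inner I (\<lambda>x. u x - \<phi> x) r"
      using d L2 L2' by (simp add: L2_inner_diff_left)
    then have "cmod (L2_inner I d q - L2_inner I u r) \<le>
        cmod (L2_inner I (\<lambda>x. d x - \<phi>' x) q) + cmod (L2_inner I (\<lambda>x. u x - \<phi> x) r)"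
      by (simp add: norm_triangle_ineq4)
    also have "\<dots> \<le> e * L2_norm I q + e * L2_norm I r"
    proof (intro add_mono)
      show "cmod (L2_inner I (\<lambda>x. d x - \<phi>' x) q) \<le> e * L2_norm I q"
        using L2_Cauchy_Schwarz[OF L2_diff[OF d L2'(2)] L2(3)]
          mult_right_mono[OF small(1) L2_norm_nonneg] by (rule order_trans)
      show "cmod (L2_inner I (\<lambda>x. u x - \<phi> x) r) \<le> e * L2_norm I r"
        using L2_Cauchy_Schwarz[OF L2_diff[OF L2(1) L2'(1)] L2(4)]
          mult_right_mono[OF small(2) L2_norm_nonneg] by (rule order_trans)
    qed
    finally show ?thesis by (simp add: K_def distrib_left)
  qed
  note bound = this
  have "cmod (L2_inner I d q - L2_inner I u r) \<le> 0 + e" if "e > 0" for e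
  proof -
    have "e / (K + 1) > 0" using that \<open>K \<ge> 0\<close> by simp
    from bound[OF this] have "cmod (L2_inner I d q - L2_inner I u r) \<le> e / (K + 1) * K" .
    also have "\<dots> \<le> e"
      using that \<open>K \<ge> 0\<close> by (simp add: field_simps)
    finally show ?thesis by simp
  qed
  then have "cmod (L2_inner I d q - L2_inner I u r) \<le> 0"
    by (rule field_le_epsilon)
  then show ?thesis by (simp add: d_def)
qed

text \<open>
  Together these say \<open>u(a) = u(b) = 0\<close>. Green's formula with \<open>q = 1\<close> shows that the derivative of
  \<open>u\<close> has integral zero; with \<open>q\<close> ranging over all primitives it shows that \<open>u\<close> and the primitive of
  its derivative have the same inner product with every square-integrable function.
\<close>

lemma W10_D:
  assumes u: "u \<in> W10 I"
  shows "(LINT x|M. D_adj I u x) = 0" and "AE x in M. u x = - primitive (D_adj I u) x"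
proof -
  have "u \<in> W1 I" using u by (simp add: W10_def)
  note L2 = D_adjoint_L2[OF D_adj_in_adjoint[OF this]]
  let ?d = "D_adj I u"
  have int: "integrable M ?d" by (rule L2_integrable[OF L2(2)])
  have "primitive (\<lambda>x. 0) x = 0" for x by (simp add: primitive_def)
  then have "(\<lambda>x. 1, \<lambda>x. 0) \<in> L2_adjoint I (D_op I)"
    by (intro D_adjoint_primitive[of _ _ 1]) (simp_all add: L2_const)
  from W10_Green[OF u this] have "(LINT x|M. - ?d x) = 0"
    by (simp add: L2_inner_def)
  then show mean: "(LINT x|M. ?d x) = 0" using int by simp
  define w where "w = (\<lambda>x. u x - (- primitive ?d x))"
  have Jd: "primitive ?d \<in> L2 I" by (rule primitive_L2[OF int])
  have w: "w \<in> L2 I" unfolding w_def by (intro L2_diff L2_uminus L2 Jd)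
  have Jw: "primitive w \<in> L2 I" by (intro primitive_L2 L2_integrable w)
  note intw = L2_integrable[OF L2_cnj[OF w]]
  have "(\<lambda>x. - primitive w x, w) \<in> L2_adjoint I (D_op I)"
    by (rule D_adjoint_primitive[of _ _ 0]) (auto intro: L2_uminus Jw w)
  from W10_Green[OF u this] have "L2_inner I u w = (LINT x|M. ?d x * primitive (\<lambda>x. cnj (w x)) x)"
    by (simp add: L2_inner_def primitive_cnj)
  also have "\<dots> = - (LINT x|M. cnj (w x) * primitive ?d x)"
    using integral_by_parts[OF intw int] mean by simp
  also have "\<dots> = L2_inner I (\<lambda>x. - primitive ?d x) w"
    by (simp add: L2_inner_def mult.commute)
  finally have "L2_inner I w w = 0"
    using L2_inner_diff_left[OF L2(1) L2_uminus[OF Jd] w] by (simp add: w_def)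
  then have "L2_norm I w = 0" by (simp add: L2_inner_self)
  then have "AE x in M. w x = 0" by (rule L2_norm_eq_0[OF w])
  then show "AE x in M. u x = - primitive ?d x" by eventually_elim (simp add: w_def add_eq_0_iff)
qed

section \<open>An explicit formula for the inverse\<close>

lemma weighted_integral_bound:
  fixes m :: "real \<Rightarrow> real" and F :: "real \<Rightarrow> complex"
  assumes m: "integrable M m" and F: "F \<in> borel_measurable M" "\<And>x. cmod (F x) \<le> B"
  shows "integrable M (\<lambda>x. of_real (m x) * F x)"
    and "(LINT x|M. cmod (of_real (m x) * F x)) \<le> (LINT x|M. \<bar>m x\<bar>) * B"
    and "cmod (LINT x|M. of_real (m x) * F x) \<le> (LINT x|M. \<bar>m x\<bar>) * B"
proof -
  have int: "integrable M (\<lambda>x. \<bar>m x\<bar> * B)" using m by simp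
  have [measurable]: "m \<in> borel_measurable M" using m by (rule borel_measurable_integrable)
  have bound: "cmod (of_real (m x) * F x) \<le> \<bar>m x\<bar> * B" for x
    using mult_left_mono[OF F(2)[of x], of "\<bar>m x\<bar>"] by (simp add: norm_mult)
  show int': "integrable M (\<lambda>x. of_real (m x) * F x)"
  proof (rule Bochner_Integration.integrable_bound[OF int])
    show "(\<lambda>x. of_real (m x) * F x) \<in> borel_measurable M"
      using F(1) by measurable
    have "norm (of_real (m x) * F x) \<le> norm (\<bar>m x\<bar> * B)" for x
      using bound[of x] abs_ge_self[of "\<bar>m x\<bar> * B"] unfolding real_norm_def by (rule order_trans)
    then show "AE x in M. norm (of_real (m x) * F x) \<le> norm (\<bar>m x\<bar> * B)"
      by simp
  qed
  have "(LINT x|M. cmod (of_real (m x) * F x)) \<le> (LINT x|M. \<bar>m x\<bar> * B)"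
    by (rule integral_mono[OF integrable_norm[OF int'] int bound])
  also have "\<dots> = (LINT x|M. \<bar>m x\<bar>) * B" by simp
  finally show *: "(LINT x|M. cmod (of_real (m x) * F x)) \<le> (LINT x|M. \<bar>m x\<bar>) * B" .
  show "cmod (LINT x|M. of_real (m x) * F x) \<le> (LINT x|M. \<bar>m x\<bar>) * B"
    using integral_norm_bound[of M "\<lambda>x. of_real (m x) * F x"] * by linarith
qed

text \<open>
  The hypotheses on the coefficients make their integral positive, which is the only number that the
  solution formula divides by.
\<close>

definition admissible :: "(real \<Rightarrow> real) \<Rightarrow> bool" where
  "admissible p \<longleftrightarrow> p \<in> Linfty I \<and> \<not> (AE x in M. p x = 0) \<and> (AE x in M. 0 \<le> p x)"

lemma admissible_L2_mult:
  assumes "admissible p" "q \<in> L2 I"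
  shows "(\<lambda>x. of_real (p x) * q x) \<in> L2 I"
proof -
  obtain C where [measurable]: "p \<in> borel_measurable M" and C: "AE x in M. \<bar>p x\<bar> \<le> C"
    using assms(1) unfolding admissible_def Linfty_def by blast
  show ?thesis
  proof (rule L2_bounded_mult[OF assms(2)])
    show "AE x in M. cmod (of_real (p x)) \<le> C"
      using C by simp
  qed measurable
qed

lemma admissible_integrable:
  assumes "admissible p"
  shows "integrable M p"
proof -
  obtain C where "p \<in> borel_measurable M" and C: "AE x in M. \<bar>p x\<bar> \<le> C"
    using assms unfolding admissible_def Linfty_def by blast
  then show ?thesis
    by (intro M.integrable_const_bound[of p C]) simp_all
qed

lemma admissible_integral_pos:
  assumes "admissible p"
  shows "0 < (LINT x|M. p x)"
proof -
  have nonneg: "AE x in M. 0 \<le> p x" and nz: "\<not> (AE x in M. p x = 0)"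
    using assms by (simp_all add: admissible_def)
  have "(LINT x|M. p x) \<noteq> 0"
    using integral_nonneg_eq_0_iff_AE[OF admissible_integrable[OF assms] nonneg] nz by blast
  moreover have "0 \<le> (LINT x|M. p x)"
    by (rule integral_nonneg_AE[OF nonneg])
  ultimately show ?thesis by simp
qed

lemma admissible_integral_abs:
  assumes "admissible p"
  shows "(LINT x|M. \<bar>p x\<bar>) = (LINT x|M. p x)"
proof (rule integral_cong_AE)
  have "AE x in M. 0 \<le> p x" using assms by (simp add: admissible_def)
  then show "AE x in M. \<bar>p x\<bar> = p x" by eventually_elim simp
qed (use borel_measurable_integrable[OF admissible_integrable[OF assms]] in measurable)

text \<open>
  The formula for the solution of \<open>-q' = f\<close>, \<open>u' - p q = g\<close> with \<open>u(a) = u(b) = 0\<close>, where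
  \<open>h = (f, g)\<close>. The first equation gives \<open>q = c - \<integral> f\<close> (\<open>flux\<close>), the second then makes \<open>u\<close> the
  primitive of \<open>g + p q\<close> (\<open>source\<close>), and \<open>u(b) = 0\<close> determines the constant \<open>c\<close> (\<open>shift\<close>).
\<close>

definition shift :: "(real \<Rightarrow> real) \<Rightarrow> cfun2 \<Rightarrow> complex" where
  "shift p h = ((LINT x|M. of_real (p x) * primitive (fst h) x) - (LINT x|M. snd h x)) / of_real (LINT x|M. p x)"

definition flux :: "(real \<Rightarrow> real) \<Rightarrow> cfun2 \<Rightarrow> real \<Rightarrow> complex" where
  "flux p h x = shift p h - primitive (fst h) x"

definition source :: "(real \<Rightarrow> real) \<Rightarrow> cfun2 \<Rightarrow> real \<Rightarrow> complex" where
  "source p h x = snd h x + of_real (p x) * flux p h x"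

lemma flux_L2: "h \<in> L2 I \<times> L2 I \<Longrightarrow> flux p h \<in> L2 I"
  unfolding flux_def[abs_def] by (auto intro!: L2_diff L2_const primitive_L2 L2_integrable)

lemma source_L2: "admissible p \<Longrightarrow> h \<in> L2 I \<times> L2 I \<Longrightarrow> source p h \<in> L2 I"
  unfolding source_def[abs_def] by (auto intro!: L2_add admissible_L2_mult flux_L2)

lemma source_mean_zero_iff:
  assumes p: "admissible p" and h: "h \<in> L2 I \<times> L2 I"
  shows "(LINT x|M. snd h x + of_real (p x) * (c - primitive (fst h) x)) = 0 \<longleftrightarrow> c = shift p h"
proof -
  have fg: "fst h \<in> L2 I" "snd h \<in> L2 I" using h by auto
  note pJ = L2_integrable[OF admissible_L2_mult[OF p primitive_L2[OF L2_integrable[OF fg(1)]]]]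
  have "(LINT x|M. snd h x + of_real (p x) * (c - primitive (fst h) x)) =
      (LINT x|M. snd h x + (of_real (p x) * c - of_real (p x) * primitive (fst h) x))"
    by (simp add: right_diff_distrib)
  also have "\<dots> = (LINT x|M. snd h x) + (of_real (LINT x|M. p x) * c - (LINT x|M. of_real (p x) * primitive (fst h) x))"
    using L2_integrable[OF fg(2)] admissible_integrable[OF p] pJ by simp
  finally show ?thesis
    using admissible_integral_pos[OF p] by (auto simp: shift_def field_simps)
qed

lemma A_hat_solution:
  assumes p: "admissible p" and h: "h \<in> L2 I \<times> L2 I"
  shows "((primitive (source p h), flux p h), h) \<in> A_hat I p"
proof -
  have fg: "fst h \<in> L2 I" "snd h \<in> L2 I" using h by auto
  have mean: "(LINT x|M. source p h x) = 0"
    using source_mean_zero_iff[OF p h, where c = "shift p h"] by (simp add: source_def flux_def)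
  have "primitive (source p h) \<in> L2 I"
    by (intro primitive_L2 L2_integrable source_L2 p h)
  note u = W10_I[OF this source_L2[OF p h] mean]
  have "(flux p h, fst h) \<in> L2_adjoint I (D_op I)"
    by (rule D_adjoint_primitive[OF flux_L2[OF h] fg(1), where c = "shift p h"]) (simp add: flux_def)
  note q = D_adj_eq_AE[OF this]
  have "AE x in M. fst h x = D_adj I (flux p h) x"
    using q(2) by eventually_elim simp
  moreover have "AE x in M. snd h x = - D_adj I (primitive (source p h)) x - of_real (p x) * flux p h x"
    using u(2)[OF AE_I2[OF refl]] by eventually_elim (simp add: source_def)
  ultimately show ?thesis
    using u(1) q(1) fg by (cases h) (simp add: A_hat_def)
qed

lemma A_hat_solution_unique:
  assumes p: "admissible p" and y: "(y, h) \<in> A_hat I p"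
  shows "h \<in> L2 I \<times> L2 I" "y \<in> L2 I \<times> L2 I"
    and "AE x in M. fst y x = primitive (source p h) x" and "AE x in M. snd y x = flux p h x"
proof -
  obtain u q f g where eq: "y = (u, q)" "h = (f, g)" by (cases y, cases h)
  have u: "u \<in> W10 I" and q: "q \<in> W1 I" and f: "f \<in> L2 I" and g: "g \<in> L2 I"
    and fq: "AE x in M. f x = D_adj I q x"
    and gu: "AE x in M. g x = - D_adj I u x - of_real (p x) * q x"
    using y by (simp_all add: A_hat_def eq)
  show h: "h \<in> L2 I \<times> L2 I" using f g by (simp add: eq)
  have "u \<in> W1 I" using u by (simp add: W10_def)
  note uL2 = D_adjoint_L2[OF D_adj_in_adjoint[OF this]]
  note qL2 = D_adjoint_L2[OF D_adj_in_adjoint[OF q]]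
  show "y \<in> L2 I \<times> L2 I" using uL2 qL2 by (simp add: eq)
  obtain c where c: "AE x in M. q x = c - primitive (D_adj I q) x"
    using D_adjoint_imp_primitive[OF D_adj_in_adjoint[OF q]] by blast
  have "primitive (D_adj I q) x = primitive f x" for x
    using fq by (intro primitive_cong_AE L2_integrable f qL2) (simp add: eq_commute)
  with c have c: "AE x in M. q x = c - primitive f x" by simp
  let ?v = "\<lambda>x. g x + of_real (p x) * (c - primitive f x)"
  have v: "?v \<in> L2 I"
    by (intro L2_add g admissible_L2_mult p L2_diff L2_const primitive_L2 L2_integrable f)
  have uv: "AE x in M. - D_adj I u x = ?v x"
    using gu c by eventually_elim simp
  have "(LINT x|M. ?v x) = (LINT x|M. - D_adj I u x)"
    using uv L2_measurable[OF v] L2_measurable[OF uL2(2)]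
    by (intro integral_cong_AE) (simp_all add: eq_commute)
  also have "\<dots> = 0" using W10_D(1)[OF u] by simp
  finally have "c = shift p h"
    using source_mean_zero_iff[OF p h, where c = c] by (simp add: eq)
  then have flux: "flux p h x = c - primitive f x" for x
    by (simp add: flux_def eq)
  show "AE x in M. snd y x = flux p h x"
    using c by (simp add: flux) (simp add: eq)
  have "- primitive (D_adj I u) x = primitive (source p h) x" for x
  proof -
    have "primitive (\<lambda>x. - D_adj I u x) x = primitive ?v x"
      by (intro primitive_cong_AE uv L2_integrable L2_uminus uL2 v)
    moreover have "source p h = ?v" by (simp add: source_def fun_eq_iff flux) (simp add: eq)
    ultimately show ?thesis by (simp add: primitive_uminus)
  qed
  then show "AE x in M. fst y x = primitive (source p h) x"
    using W10_D(2)[OF u] by (simp add: eq)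
qed

text \<open>
  Existence of a solution is what makes the chosen preimage a genuine one; uniqueness then identifies
  it, up to null sets, with the explicit formula.
\<close>

lemma A_hat_inv_AE:
  assumes p: "admissible p" and h: "h \<in> L2 I \<times> L2 I"
  shows "A_hat_inv I p h \<in> L2 I \<times> L2 I"
    and "AE x in M. fst (A_hat_inv I p h) x = primitive (source p h) x"
    and "AE x in M. snd (A_hat_inv I p h) x = flux p h x"
proof -
  have "(h, (primitive (source p h), flux p h)) \<in> (A_hat I p)\<inverse>"
    using A_hat_solution[OF p h] by simp
  then have "(h, A_hat_inv I p h) \<in> (A_hat I p)\<inverse>"
    unfolding A_hat_inv_def op_apply_def by (rule someI)
  then have "(A_hat_inv I p h, h) \<in> A_hat I p" by simp
  from A_hat_solution_unique[OF p this]
  show "A_hat_inv I p h \<in> L2 I \<times> L2 I"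
    and "AE x in M. fst (A_hat_inv I p h) x = primitive (source p h) x"
    and "AE x in M. snd (A_hat_inv I p h) x = flux p h x"
    by simp_all
qed

section \<open>Dependence of the inverse on the coefficient\<close>

lemma L2_prod_norm_le: "L2_prod_norm I h \<le> L2_norm I (fst h) + L2_norm I (snd h)"
  unfolding L2_prod_norm_def by (intro real_le_lsqrt) (simp_all add: L2_norm_nonneg power2_sum)

lemma L2_prod_norm_ge: "L2_norm I (fst h) \<le> L2_prod_norm I h" "L2_norm I (snd h) \<le> L2_prod_norm I h"
  by (simp_all add: L2_prod_norm_def real_le_rsqrt)

text \<open>
  These bounds are uniform over the unit ball and over all coefficients whose integral is at least
  \<open>P/2\<close>; in particular they do not involve the supremum of the coefficient, on which the
  convergence in \<open>L\<^sup>1\<close> gives no control.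
\<close>

lemma shift_bound:
  assumes p: "admissible p" and h: "h \<in> L2 I \<times> L2 I" "L2_prod_norm I h \<le> 1"
    and P: "0 < P" "P / 2 \<le> (LINT x|M. p x)"
  shows "cmod (primitive (fst h) x) \<le> sqrt (b - a)"
    and "cmod (shift p h) \<le> sqrt (b - a) + 2 * sqrt (b - a) / P"
proof -
  let ?s = "sqrt (b - a)" and ?Q = "LINT x|M. p x"
  have fg: "fst h \<in> L2 I" "snd h \<in> L2 I" using h by auto
  have s: "0 \<le> ?s" using a_less_b by simp
  have N: "L2_norm I (fst h) \<le> 1" "L2_norm I (snd h) \<le> 1"
    using L2_prod_norm_ge[of h] h(2) by linarith+
  show primitive: "cmod (primitive (fst h) x) \<le> ?s" for x
    using primitive_bound[OF L2_integrable[OF fg(1)], of x] L1_le_L2_norm[OF fg(1)]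
      mult_left_mono[OF N(1) s] by linarith
  have Q: "0 < ?Q" by (rule admissible_integral_pos[OF p])
  have "cmod (LINT x|M. of_real (p x) * primitive (fst h) x) \<le> ?Q * ?s"
    using weighted_integral_bound(3)[OF admissible_integrable[OF p] primitive_measurable[OF L2_integrable[OF fg(1)]] primitive]
    by (simp only: admissible_integral_abs[OF p])
  moreover have "cmod (LINT x|M. snd h x) \<le> ?s"
    using norm_integral_le_L2_norm[OF fg(2)] mult_left_mono[OF N(2) s] by linarith
  ultimately have "cmod ((LINT x|M. of_real (p x) * primitive (fst h) x) - (LINT x|M. snd h x)) \<le> ?Q * ?s + ?s"
    using norm_triangle_ineq4[of "LINT x|M. of_real (p x) * primitive (fst h) x" "LINT x|M. snd h x"] by linarith
  then have "cmod (shift p h) \<le> (?Q * ?s + ?s) / ?Q"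
    using Q unfolding shift_def norm_divide norm_of_real by (simp add: divide_right_mono)
  also have "\<dots> = ?s + ?s / ?Q" using Q by (simp add: field_simps)
  also have "\<dots> \<le> ?s + ?s / (P / 2)"
    using divide_left_mono[OF P(2) s] P(1) Q by simp
  finally show "cmod (shift p h) \<le> ?s + 2 * ?s / P" by (simp add: mult.commute)
qed

text \<open>
  The inverse is locally Lipschitz in the \<open>L\<^sup>1\<close>-norm of the coefficient. The two \<open>q\<close>-components differ
  by the constant \<open>c - c'\<close>, for which
  \<open>(c - c') \<integral> p' = \<integral> (p - p') \<integral> f - c \<integral> (p - p')\<close>;
  the \<open>u\<close>-components are primitives of \<open>p q\<close> and \<open>p' q'\<close>, and
  \<open>p q - p' q' = (p - p') q + p' (c - c')\<close>. The number \<open>K\<close> bounds \<open>q\<close> uniformly.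
\<close>

lemma A_hat_inv_difference_bound:
  assumes p: "admissible p" and p': "admissible p'" and h: "h \<in> L2 I \<times> L2 I" "L2_prod_norm I h \<le> 1"
  defines "P \<equiv> LINT x|M. p' x" and "\<delta> \<equiv> L1_norm I (\<lambda>x. p x - p' x)"
  defines "K \<equiv> sqrt (b - a) + (sqrt (b - a) + 2 * sqrt (b - a) / P)"
  assumes small: "\<delta> \<le> P / 2"
  shows "L2_prod_norm I (A_hat_inv I p h - A_hat_inv I p' h) \<le> K * (2 + 1 / P) * sqrt (b - a) * \<delta>"
proof -
  let ?s = "sqrt (b - a)" and ?Q = "LINT x|M. p x"
  let ?f = "fst h" and ?g = "snd h"
  have fg: "?f \<in> L2 I" "?g \<in> L2 I" using h by auto
  note pint = admissible_integrable[OF p] and p'int = admissible_integrable[OF p']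
  have dint: "integrable M (\<lambda>x. p x - p' x)" using pint p'int by simp
  have P: "0 < P" unfolding P_def by (rule admissible_integral_pos[OF p'])
  have \<delta>: "\<delta> = (LINT x|M. \<bar>p x - p' x\<bar>)" by (simp add: \<delta>_def L1_norm_def)
  have \<delta>0: "0 \<le> \<delta>" by (simp add: \<delta>)
  have QP: "\<bar>?Q - P\<bar> \<le> \<delta>"
    using integral_norm_bound[of M "\<lambda>x. p x - p' x"] pint p'int by (simp add: \<delta> P_def)
  then have Q: "P / 2 \<le> ?Q" using small by linarith
  note bounds = shift_bound[OF p h P Q]
  define c where "c = shift p h"
  define c' where "c' = shift p' h"
  have primitive_meas: "primitive ?f \<in> borel_measurable M" by (rule primitive_measurable[OF L2_integrable[OF fg(1)]])
  have c: "cmod c \<le> K - ?s" using bounds(2) by (simp add: c_def K_def)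
  have K0: "0 \<le> K" using P a_less_b by (simp add: K_def)
  have flux: "cmod (flux p h x) \<le> K" for x
    using norm_triangle_ineq4[of c "primitive ?f x"] bounds(1)[of x] c by (simp add: flux_def c_def)
  have cc': "cmod (c - c') \<le> K * \<delta> / P"
  proof -
    have linear: "(c - c') * R' = D - c * (R - R')"
      if "c * R = A - G" "c' * R' = B - G" "D = A - B" for A B D G R R' :: complex
      using that by algebra
    have "c * of_real ?Q = (LINT x|M. of_real (p x) * primitive ?f x) - (LINT x|M. ?g x)"
      using admissible_integral_pos[OF p] by (simp add: c_def shift_def)
    moreover have "c' * of_real P = (LINT x|M. of_real (p' x) * primitive ?f x) - (LINT x|M. ?g x)"
      using P by (simp add: c'_def shift_def P_def)
    moreover have "(LINT x|M. of_real (p x - p' x) * primitive ?f x) =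
        (LINT x|M. of_real (p x) * primitive ?f x) - (LINT x|M. of_real (p' x) * primitive ?f x)"
      using weighted_integral_bound(1)[OF pint primitive_meas bounds(1)]
        weighted_integral_bound(1)[OF p'int primitive_meas bounds(1)]
      by (simp add: left_diff_distrib)
    ultimately have "(c - c') * of_real P =
        (LINT x|M. of_real (p x - p' x) * primitive ?f x) - c * of_real (?Q - P)"
      unfolding of_real_diff[of ?Q P] by (rule linear)
    then have "cmod (c - c') * P =
        cmod ((LINT x|M. of_real (p x - p' x) * primitive ?f x) - c * of_real (?Q - P))"
      using P by (metis norm_mult norm_of_real abs_of_pos)
    also have "\<dots> \<le> cmod (LINT x|M. of_real (p x - p' x) * primitive ?f x) + cmod c * \<bar>?Q - P\<bar>"
      using norm_triangle_ineq4[of "LINT x|M. of_real (p x - p' x) * primitive ?f x" "c * of_real (?Q - P)"]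
      by (simp only: norm_mult norm_of_real)
    also have "\<dots> \<le> \<delta> * ?s + (K - ?s) * \<delta>"
    proof (rule add_mono)
      show "cmod (LINT x|M. of_real (p x - p' x) * primitive ?f x) \<le> \<delta> * ?s"
        unfolding \<delta> by (rule weighted_integral_bound(3)[OF dint primitive_meas bounds(1)])
      show "cmod c * \<bar>?Q - P\<bar> \<le> (K - ?s) * \<delta>"
        using c QP norm_ge_zero[of c] by (intro mult_mono) linarith+
    qed
    also have "\<dots> = K * \<delta>" by (simp add: algebra_simps)
    finally show ?thesis using P by (simp add: field_simps)
  qed
  have flux_diff: "flux p h x - flux p' h x = c - c'" for x
    by (simp add: flux_def c_def c'_def)
  have primitive_diff: "cmod (primitive (source p h) x - primitive (source p' h) x) \<le> 2 * K * \<delta>" for x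
  proof -
    note v = L2_integrable[OF source_L2[OF p h(1)]] L2_integrable[OF source_L2[OF p' h(1)]]
    have fm: "flux p h \<in> borel_measurable M" by (rule L2_measurable[OF flux_L2[OF h(1)]])
    note w1 = weighted_integral_bound[OF dint fm flux]
    note w2 = weighted_integral_bound[OF p'int borel_measurable_const order_refl, of "c - c'"]
    have eq: "source p h t - source p' h t =
        of_real (p t - p' t) * flux p h t + of_real (p' t) * (c - c')" for t
      by (simp add: source_def flux_diff[of t, symmetric] algebra_simps)
    have "cmod (primitive (source p h) x - primitive (source p' h) x) = cmod (primitive (\<lambda>t. source p h t - source p' h t) x)"
      by (simp add: primitive_diff[OF v])
    also have "\<dots> \<le> (LINT t|M. cmod (source p h t - source p' h t))"
      by (rule primitive_bound) (use v in simp)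
    also have "\<dots> \<le> (LINT t|M. cmod (of_real (p t - p' t) * flux p h t) + cmod (of_real (p' t) * (c - c')))"
    proof (rule integral_mono)
      show "integrable M (\<lambda>t. cmod (source p h t - source p' h t))" using v by simp
      show "integrable M (\<lambda>t. cmod (of_real (p t - p' t) * flux p h t) + cmod (of_real (p' t) * (c - c')))"
        by (intro Bochner_Integration.integrable_add integrable_norm w1(1) w2(1))
      show "cmod (source p h t - source p' h t) \<le>
          cmod (of_real (p t - p' t) * flux p h t) + cmod (of_real (p' t) * (c - c'))" for t
        unfolding eq by (rule norm_triangle_ineq)
    qed
    also have "\<dots> = (LINT t|M. cmod (of_real (p t - p' t) * flux p h t)) +
        (LINT t|M. cmod (of_real (p' t) * (c - c')))"
      by (intro Bochner_Integration.integral_add integrable_norm w1(1) w2(1))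
    also have "\<dots> \<le> \<delta> * K + P * cmod (c - c')"
      using w1(2) w2(2) unfolding admissible_integral_abs[OF p'] \<delta> P_def by linarith
    also have "\<dots> \<le> \<delta> * K + P * (K * \<delta> / P)"
      using mult_left_mono[OF cc', of P] P by simp
    also have "\<dots> = 2 * K * \<delta>" using P by simp
    finally show ?thesis .
  qed
  let ?y = "A_hat_inv I p h" and ?y' = "A_hat_inv I p' h"
  note y = A_hat_inv_AE[OF p h(1)] and y' = A_hat_inv_AE[OF p' h(1)]
  have L2: "fst ?y \<in> L2 I" "snd ?y \<in> L2 I" "fst ?y' \<in> L2 I" "snd ?y' \<in> L2 I"
    using y(1) y'(1) by (auto simp: mem_Times_iff)
  have "L2_norm I (\<lambda>x. fst ?y x - fst ?y' x) \<le> 2 * K * \<delta> * ?s"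
  proof (rule L2_norm_le_bound[OF L2_diff[OF L2(1,3)]])
    show "AE x in M. cmod (fst ?y x - fst ?y' x) \<le> 2 * K * \<delta>"
      using y(2) y'(2) by eventually_elim (simp add: primitive_diff)
  qed (use K0 \<delta>0 in simp)
  moreover have "L2_norm I (\<lambda>x. snd ?y x - snd ?y' x) \<le> K * \<delta> / P * ?s"
  proof (rule L2_norm_le_bound[OF L2_diff[OF L2(2,4)]])
    show "AE x in M. cmod (snd ?y x - snd ?y' x) \<le> K * \<delta> / P"
      using y(3) y'(3) by eventually_elim (simp add: flux_diff cc')
  qed (use K0 \<delta>0 P in simp)
  moreover have "fst (?y - ?y') = (\<lambda>x. fst ?y x - fst ?y' x)" "snd (?y - ?y') = (\<lambda>x. snd ?y x - snd ?y' x)"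
    by (simp_all add: fun_eq_iff)
  ultimately have "L2_prod_norm I (?y - ?y') \<le> 2 * K * \<delta> * ?s + K * \<delta> / P * ?s"
    using L2_prod_norm_le[of "?y - ?y'"] by simp
  also have "\<dots> = K * (2 + 1 / P) * ?s * \<delta>" by (simp add: algebra_simps)
  finally show ?thesis .
qed

lemma A_hat_inv_tendsto:
  assumes p': "admissible p'" and p: "\<And>\<nu>. 1 \<le> \<nu> \<Longrightarrow> admissible (p \<nu>)"
    and lim: "(\<lambda>\<nu>::nat. L1_norm I (\<lambda>x. p \<nu> x - p' x)) \<longlonglongrightarrow> 0"
  shows "(\<lambda>\<nu>. L2_prod_opnorm I (\<lambda>h. A_hat_inv I (p \<nu>) h - A_hat_inv I p' h)) \<longlonglongrightarrow> 0"
proof -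
  define P where "P = (LINT x|M. p' x)"
  define C where "C = (sqrt (b - a) + (sqrt (b - a) + 2 * sqrt (b - a) / P)) * (2 + 1 / P) * sqrt (b - a)"
  have "0 < P" unfolding P_def by (rule admissible_integral_pos[OF p'])
  then have "0 < P / 2" by simp
  have bound: "\<forall>\<^sub>F \<nu> in sequentially. L2_prod_opnorm I (\<lambda>h. A_hat_inv I (p \<nu>) h - A_hat_inv I p' h)
      \<le> ennreal (C * L1_norm I (\<lambda>x. p \<nu> x - p' x))"
    using order_tendstoD(2)[OF lim \<open>0 < P / 2\<close>] eventually_ge_at_top[of 1]
  proof eventually_elim
    case (elim \<nu>)
    show ?case
      unfolding L2_prod_opnorm_def
    proof (rule SUP_least, rule ennreal_leI)
      fix h assume "h \<in> {h \<in> L2 I \<times> L2 I. L2_prod_norm I h \<le> 1}"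
      then show "L2_prod_norm I (A_hat_inv I (p \<nu>) h - A_hat_inv I p' h)
          \<le> C * L1_norm I (\<lambda>x. p \<nu> x - p' x)"
        unfolding C_def P_def
        using elim(1) by (intro A_hat_inv_difference_bound p p' elim(2)) (simp_all add: P_def)
    qed
  qed
  have "(\<lambda>\<nu>. ennreal (C * L1_norm I (\<lambda>x. p \<nu> x - p' x))) \<longlonglongrightarrow> ennreal (C * 0)"
    by (intro tendsto_ennrealI tendsto_mult tendsto_const lim)
  then have "(\<lambda>\<nu>. ennreal (C * L1_norm I (\<lambda>x. p \<nu> x - p' x))) \<longlonglongrightarrow> 0" by simp
  from tendsto_sandwich[OF _ bound tendsto_const this] show ?thesis by simp
qed

end

theorem corollary6p0p4:
  fixes a b :: real
    and p_inf :: "real \<Rightarrow> real"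
    and p :: "nat \<Rightarrow> real \<Rightarrow> real"
  defines "I \<equiv> {a<..<b}"
  assumes "a < b"
    and "p_inf \<in> Linfty I"
    and "\<not> (AE x in lebesgue_on I. p_inf x = 0)"
    and "AE x in lebesgue_on I. 0 \<le> p_inf x"
    and "\<And>\<nu>. 1 \<le> \<nu> \<Longrightarrow> p \<nu> \<in> Linfty I"
    and "\<And>\<nu>. 1 \<le> \<nu> \<Longrightarrow> \<not> (AE x in lebesgue_on I. p \<nu> x = 0)"
    and "\<And>\<nu>. 1 \<le> \<nu> \<Longrightarrow> AE x in lebesgue_on I. 0 \<le> p \<nu> x"
    and "(\<lambda>\<nu>. L1_norm I (\<lambda>x. p \<nu> x - p_inf x)) \<longlonglongrightarrow> 0"
  shows "(\<lambda>\<nu>. L2_prod_opnorm I (\<lambda>h. A_hat_inv I (p \<nu>) h - A_hat_inv I p_inf h)) \<longlonglongrightarrow> 0"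
proof -
  interpret bounded_interval a b
    by unfold_locales (rule assms(2))
  show ?thesis
    using assms(3-9) unfolding I_def
    by (intro A_hat_inv_tendsto) (simp_all add: admissible_def)
qed

end
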